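(* There exists an (infinite) weighted graph $(X,\mu)$ with a reference point $o\in X$ which satisfies $F_1<F_2$, satisfies $(U)$, and $$\liminf_{n\to\infty}\frac{E_o[R_n]}{n}=1-F_2\quad\text{and}\quad\limsup_{n\to\infty}\frac{E_o[R_n]}{n}=1-F_1 .$$
   Context: A weighted graph $(X,\mu)$ is an infinite connected graph $X$ with a symmetric function $\mu:X\times X\to[0,\infty)$, $(x,y)\mapsto\mu_{xy}$, such that $\mu_{xy}>0$ if and only if $x\sim y$ (i.e. $x$ and $y$ are joined by an edge). Standing assumptions: $\sup_{x\in X}\deg(x)<+\infty$ and $0<\inf_{x\sim y}\mu_{xy}\le\sup_{x\sim y}\mu_{xy}<+\infty$. Put $\mu_x=\sum_{y\in X}\mu_{xy}$. $\{S_n\}_{n\ge0}$ is the Markov chain on $X$ with transition probabilities $P(S_{n+1}=y\mid S_n=x)=\mu_{xy}/\mu_x$; $P_x$ (expectation $E_x$) is its law when $S_0=x$. The range is $R_n=|\{S_0,\dots,S_{n-1}\}|$. Let $T_x^+=\inf\{n\ge1:S_n=x\}$, $F_1=\inf_{x\in X}P_x(T_x^+<+\infty)$, $F_2=\sup_{x\in X}P_x(T_x^+<+\infty)$. Let $d$ be the graph metric, $B(x,n)=\{y\in X:d(x,y)<n\}$. For $f:X\to\mathbb{R}$ let $\mathcal{E}(f,f)=\frac12\sum_{x,y\in X,\,x\sim y}(f(x)-f(y))^2\mu_{xy}$ and for disjoint $A,B\subset X$ define the effective resistance by $R_{\mathrm{eff}}(A,B)^{-1}=\inf\{\mathcal{E}(f,f):f|_A=1,\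 f|_B=0\}$. Let $\rho(x,n)=R_{\mathrm{eff}}(\{x\},B(x,n)^c)$ and $\rho(x)=\lim_{n\to\infty}\rho(x,n)\in(0,+\infty]$. If the chain is recurrent then $\rho(x)=+\infty$ for all $x$; if it is transient then $\rho(x)<+\infty$ for all $x$. Condition $(U)$: $\rho(x,n)$ converges to $\rho(x)$ as $n\to\infty$ uniformly in $x\in X$ (in the recurrent case this means $\inf_{x\in X}\rho(x,n)\to+\infty$). *)

theory Defs
  imports "HOL-Probability.Probability"
begin

text \<open>
  The vertex set is the whole type \<open>'a\<close>, \<open>E\<close> is the adjacency relation and \<open>\<mu>\<close> the edge weight.
  The bounds on degrees and weights are the standing assumptions
  \<open>sup deg < \<infinity>\<close> and \<open>0 < inf \<mu> \<le> sup \<mu> < \<infinity>\<close> (over edges).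
\<close>

locale weighted_graph =
  fixes E :: "'a \<Rightarrow> 'a \<Rightarrow> bool" and \<mu> :: "'a \<Rightarrow> 'a \<Rightarrow> real"
  assumes infinite_vertices: "infinite (UNIV :: 'a set)"
    and adj_sym: "E x y \<Longrightarrow> E y x"
    and adj_irrefl: "\<not> E x x"
    and connected: "E\<^sup>*\<^sup>* x y"
    and weight_sym: "\<mu> x y = \<mu> y x"
    and weight_nonneg: "0 \<le> \<mu> x y"
    and weight_pos_iff: "0 < \<mu> x y \<longleftrightarrow> E x y"
    and bounded_degree: "\<exists>D. \<forall>x. finite {y. E x y} \<and> card {y. E x y} \<le> D"
    and weight_bounded_below: "\<exists>c>0. \<forall>x y. E x y \<longrightarrow> c \<le> \<mu> x y"
    and weight_bounded_above: "\<exists>C. \<forall>x y. E x y \<longrightarrow> \<mu> x y \<le> C"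

definition vertex_weight :: "('a \<Rightarrow> 'a \<Rightarrow> real) \<Rightarrow> 'a \<Rightarrow> real" where
  "vertex_weight \<mu> x = (\<Sum>\<^sub>\<infinity>y. \<mu> x y)"

definition graph_dist :: "('a \<Rightarrow> 'a \<Rightarrow> bool) \<Rightarrow> 'a \<Rightarrow> 'a \<Rightarrow> nat" where
  "graph_dist E x y = (LEAST n. (E ^^ n) x y)"

definition graph_ball :: "('a \<Rightarrow> 'a \<Rightarrow> bool) \<Rightarrow> 'a \<Rightarrow> nat \<Rightarrow> 'a set" where
  "graph_ball E x n = {y. graph_dist E x y < n}"

text \<open>
  The law on \<open>nat \<Rightarrow> 'a\<close> of the chain with transition kernel \<open>K\<close> started at \<open>x\<close>, obtained from the
  Ionescu-Tulcea theorem: the law of \<open>S\<^sub>0\<close> is the point mass at \<open>x\<close>, and the conditional law of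
  \<open>S\<^sub>i\<close> given \<open>S\<^sub>0, \<dots>, S\<^sub>i\<^sub>-\<^sub>1\<close> is \<open>K S\<^sub>i\<^sub>-\<^sub>1\<close>.
\<close>

definition path_kernel :: "('a \<Rightarrow> 'a pmf) \<Rightarrow> 'a \<Rightarrow> nat \<Rightarrow> (nat \<Rightarrow> 'a) \<Rightarrow> 'a measure" where
  "path_kernel K x i \<omega> = measure_pmf (if i = 0 then return_pmf x else K (\<omega> (i - 1)))"

definition path_law :: "('a \<Rightarrow> 'a pmf) \<Rightarrow> 'a \<Rightarrow> (nat \<Rightarrow> 'a) measure" where
  "path_law K x = projective_family.lim UNIV
     (Ionescu_Tulcea.CI (path_kernel K x) (\<lambda>_. count_space UNIV)) (\<lambda>_. count_space UNIV)"

lemma Ionescu_Tulcea_path_kernel: "Ionescu_Tulcea (path_kernel K x) (\<lambda>_. count_space UNIV)"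
proof (rule Ionescu_Tulcea.intro)
  fix i
  have K: "(\<lambda>y. measure_pmf (K y)) \<in> count_space UNIV \<rightarrow>\<^sub>M subprob_algebra (count_space UNIV)"
    by (simp add: space_subprob_algebra measure_pmf.subprob_space_axioms)
  show "path_kernel K x i \<in> PiM {0..<i} (\<lambda>_. count_space UNIV) \<rightarrow>\<^sub>M subprob_algebra (count_space UNIV)"
  proof (cases "i = 0")
    case True
    then show ?thesis
      by (simp add: path_kernel_def[abs_def] space_subprob_algebra measure_pmf.subprob_space_axioms)
  next
    case False
    then have "(\<lambda>\<omega>. \<omega> (i - 1)) \<in> PiM {0..<i} (\<lambda>_. count_space UNIV) \<rightarrow>\<^sub>M (count_space UNIV :: 'a measure)"
      by (intro measurable_component_singleton) auto
    from measurable_compose[OF this K] False show ?thesis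
      by (simp add: path_kernel_def[abs_def])
  qed
next
  show "prob_space (path_kernel K x i \<omega>)" for i \<omega>
    by (simp add: path_kernel_def measure_pmf.prob_space_axioms)
qed

lemma sets_path_law: "sets (path_law K x) = sets (PiM UNIV (\<lambda>_. count_space UNIV))"
proof -
  interpret Ionescu_Tulcea "path_kernel K x" "\<lambda>_. count_space UNIV"
    by (rule Ionescu_Tulcea_path_kernel)
  show ?thesis unfolding path_law_def by (rule PF.sets_lim)
qed

lemma space_path_law: "space (path_law K x) = UNIV"
  using sets_eq_imp_space_eq[OF sets_path_law] by (simp add: space_PiM)

lemma path_law_cylinder:
  "emeasure (path_law K x) {\<omega>. \<forall>i\<le>n. \<omega> i = s i} =
     ennreal (indicator {x} (s 0) * (\<Prod>i<n. pmf (K (s i)) (s (Suc i))))"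
proof -
  let ?N = "\<lambda>_ :: nat. count_space (UNIV :: 'a set)"
  interpret Ionescu_Tulcea "path_kernel K x" ?N
    by (rule Ionescu_Tulcea_path_kernel)
  define X where "X m = {restrict s {0..<m}}" for m
  have X_eq: "X m = PiE {0..<m} (\<lambda>i. {s i})" for m
    by (auto simp: X_def PiE_iff extensional_def restrict_def fun_eq_iff)
  have X_sets[measurable]: "X m \<in> sets (PiM {0..<m} ?N)" for m
    unfolding X_eq by (intro sets_PiM_I_finite) auto
  have und: "(\<lambda>x. undefined) \<in> space (PiM {0..<0} ?N)" by (simp add: space_PiM)
  have C_eq: "emeasure (C 0 (Suc m) (\<lambda>x. undefined)) (X (Suc m)) =
      ennreal (indicator {x} (s 0) * (\<Prod>i<m. pmf (K (s i)) (s (Suc i))))" for m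
  proof -
    have vim: "fun_upd \<omega> k -` X (Suc k) \<inter> UNIV = (if \<omega> \<in> X k then {s k} else {})"
      if "\<omega> \<in> space (PiM {0..<k} ?N)" for k \<omega>
    proof -
      have ext: "\<omega> \<in> extensional {0..<k}" using that by (simp add: space_PiM PiE_def)
      have "fun_upd \<omega> k y = restrict s {0..<Suc k} \<longleftrightarrow> \<omega> = restrict s {0..<k} \<and> y = s k" for y
      proof
        assume *: "fun_upd \<omega> k y = restrict s {0..<Suc k}"
        have "\<omega> i = restrict s {0..<k} i" for i
          using fun_cong[OF *, of i] ext
          by (cases "i < k") (auto simp: extensional_def)
        moreover have "y = s k" using fun_cong[OF *, of k] by simp
        ultimately show "\<omega> = restrict s {0..<k} \<and> y = s k" by auto
      qed (auto simp: fun_eq_iff)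
      then show ?thesis by (auto simp: X_def)
    qed
    have eP_X: "emeasure (eP k \<omega>) (X (Suc k)) =
        indicator (X k) \<omega> * emeasure (path_kernel K x k (restrict s {0..<k})) {s k}"
      if "\<omega> \<in> space (PiM {0..<k} ?N)" for k \<omega>
    proof (cases "\<omega> \<in> X k")
      case True
      then have *: "restrict s {0..<k} = \<omega>" by (simp add: X_def)
      show ?thesis
        unfolding * emeasure_eP[OF that X_sets] space_count_space vim[OF that]
        using True by simp
    next
      case False
      with that show ?thesis
        by (simp only: emeasure_eP[OF that X_sets] space_count_space vim[OF that]) simp
    qed
    have step: "emeasure (C 0 (Suc k) (\<lambda>x. undefined)) (X (Suc k)) =
        emeasure (path_kernel K x k (restrict s {0..<k})) {s k} *
        emeasure (C 0 k (\<lambda>x. undefined)) (X k)" for k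
    proof -
      have spC: "space (C 0 k (\<lambda>x. undefined)) = space (PiM {0..<k} ?N)"
        using space_C[OF und, of k] by simp
      have sC: "sets (C 0 k (\<lambda>x. undefined)) = sets (PiM {0..<k} ?N)"
        using sets_C[OF und, of k] by simp
      have "emeasure (C 0 (Suc k) (\<lambda>x. undefined)) (X (Suc k)) =
          (\<integral>\<^sup>+\<omega>. emeasure (eP k \<omega>) (X (Suc k)) \<partial>C 0 k (\<lambda>x. undefined))"
        using prob_space.not_empty[OF prob_space_C[OF und, of k]] measurable_eP[of k]
        by (simp, subst emeasure_bind[where N="PiM {0..<Suc k} ?N"])
           (auto simp: measurable_cong_sets[OF sC refl])
      also have "\<dots> = (\<integral>\<^sup>+\<omega>. emeasure (path_kernel K x k (restrict s {0..<k})) {s k} *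
          indicator (X k) \<omega> \<partial>C 0 k (\<lambda>x. undefined))"
        by (intro nn_integral_cong) (simp add: spC eP_X mult.commute)
      also have "\<dots> = emeasure (path_kernel K x k (restrict s {0..<k})) {s k} *
          emeasure (C 0 k (\<lambda>x. undefined)) (X k)"
        by (rule nn_integral_cmult_indicator) (simp add: sC)
      finally show ?thesis .
    qed
    show ?thesis
    proof (induction m)
      case 0
      have "emeasure (C 0 0 (\<lambda>x. undefined)) (X 0) = 1"
        using X_sets[of 0] by (simp add: X_def restrict_def indicator_def)
      moreover have "emeasure (path_kernel K x 0 \<omega>) {s 0} = ennreal (indicator {x} (s 0))" for \<omega>
        by (simp add: path_kernel_def emeasure_pmf_single indicator_def)
      ultimately show ?case
        unfolding step[of 0] by simp
    next
      case (Suc m)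
      have "emeasure (path_kernel K x (Suc m) (restrict s {0..<Suc m})) {s (Suc m)} =
          ennreal (pmf (K (s m)) (s (Suc m)))"
        by (simp add: path_kernel_def emeasure_pmf_single)
      then show ?case
        unfolding step[of "Suc m"] Suc.IH
        by (simp add: ennreal_mult[symmetric] prod_nonneg mult_ac)
    qed
  qed
  have "{\<omega>. \<forall>i\<le>n. \<omega> i = s i} = prod_emb UNIV ?N {0..<Suc n} (X (Suc n))"
    by (auto simp: prod_emb_def space_PiM X_def fun_eq_iff restrict_def) (metis less_Suc_eq_le)
  then have "emeasure (path_law K x) {\<omega>. \<forall>i\<le>n. \<omega> i = s i} = emeasure (CI {0..<Suc n}) (X (Suc n))"
    unfolding path_law_def by (simp only: lim[OF finite_atLeastLessThan X_sets])
  also have "\<dots> = emeasure (C 0 (Suc n) (\<lambda>x. undefined)) (X (Suc n))"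
    by (simp only: emeasure_CI[OF order_refl X_sets] prod_emb_id[OF sets.sets_into_space[OF X_sets, unfolded space_PiM]])
  finally show ?thesis by (simp only: C_eq)
qed

definition walk_step :: "('a \<Rightarrow> 'a \<Rightarrow> real) \<Rightarrow> 'a \<Rightarrow> 'a pmf" where
  "walk_step \<mu> x = embed_pmf (\<lambda>y. \<mu> x y / vertex_weight \<mu> x)"

lemma (in weighted_graph) pmf_walk_step: "pmf (walk_step \<mu> x) y = \<mu> x y / vertex_weight \<mu> x"
proof -
  let ?A = "{y. E x y}"
  have fin: "finite ?A" using bounded_degree by blast
  have zero: "\<mu> x y = 0" if "y \<notin> ?A" for y
    using weight_pos_iff[of x y] weight_nonneg[of x y] that by auto
  have vw: "vertex_weight \<mu> x = (\<Sum>y\<in>?A. \<mu> x y)"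
    unfolding vertex_weight_def using fin zero
    by (subst infsum_cong_neutral[where T = ?A and g = "\<mu> x"]) auto
  obtain z where "z \<noteq> x"
    using infinite_vertices by (metis finite.emptyI finite_insert insertI1 UNIV_eq_I)
  with connected[of x z] obtain y0 where "E x y0"
    by (auto elim: converse_rtranclpE)
  then have pos: "vertex_weight \<mu> x > 0"
    unfolding vw using fin weight_nonneg weight_pos_iff by (intro sum_pos2[of _ y0]) auto
  have "(\<integral>\<^sup>+y. ennreal (\<mu> x y / vertex_weight \<mu> x) \<partial>count_space UNIV) =
      (\<Sum>y\<in>?A. ennreal (\<mu> x y / vertex_weight \<mu> x))"
    using fin zero by (intro nn_integral_count_space'[where A = ?A]) auto
  also have "\<dots> = ennreal (\<Sum>y\<in>?A. \<mu> x y / vertex_weight \<mu> x)"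
    using pos weight_nonneg by (intro sum_ennreal) auto
  also have "\<dots> = 1" using pos by (simp add: sum_divide_distrib[symmetric] vw[symmetric])
  finally show ?thesis
    unfolding walk_step_def using pos weight_nonneg by (intro pmf_embed_pmf) auto
qed

definition walk_law :: "('a \<Rightarrow> 'a \<Rightarrow> real) \<Rightarrow> 'a \<Rightarrow> (nat \<Rightarrow> 'a) measure" where
  "walk_law \<mu> x = path_law (walk_step \<mu>) x"

definition return_time :: "'a \<Rightarrow> (nat \<Rightarrow> 'a) \<Rightarrow> enat" where
  "return_time x \<omega> = Inf {enat n |n. 1 \<le> n \<and> \<omega> n = x}"

definition return_prob :: "('a \<Rightarrow> 'a \<Rightarrow> real) \<Rightarrow> 'a \<Rightarrow> real" where
  "return_prob \<mu> x = measure (walk_law \<mu> x) {\<omega> \<in> space (walk_law \<mu> x). return_time x \<omega> < \<infinity>}"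

definition F1 :: "('a \<Rightarrow> 'a \<Rightarrow> real) \<Rightarrow> real" where
  "F1 \<mu> = (INF x. return_prob \<mu> x)"

definition F2 :: "('a \<Rightarrow> 'a \<Rightarrow> real) \<Rightarrow> real" where
  "F2 \<mu> = (SUP x. return_prob \<mu> x)"

definition walk_range :: "nat \<Rightarrow> (nat \<Rightarrow> 'a) \<Rightarrow> nat" where
  "walk_range n \<omega> = card (\<omega> ` {..<n})"

definition expected_range :: "('a \<Rightarrow> 'a \<Rightarrow> real) \<Rightarrow> 'a \<Rightarrow> nat \<Rightarrow> real" where
  "expected_range \<mu> x n = (\<integral>\<omega>. real (walk_range n \<omega>) \<partial>walk_law \<mu> x)"

definition energy :: "('a \<Rightarrow> 'a \<Rightarrow> bool) \<Rightarrow> ('a \<Rightarrow> 'a \<Rightarrow> real) \<Rightarrow> ('a \<Rightarrow> real) \<Rightarrow> ennreal" where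
  "energy E \<mu> f = (\<Sum>\<^sub>\<infinity>(x, y)\<in>{(x, y). E x y}. ennreal ((f x - f y)\<^sup>2 * \<mu> x y)) / 2"

text \<open>In \<^typ>\<open>ennreal\<close>, \<open>inverse 0 = \<infinity>\<close> and \<open>inverse \<infinity> = 0\<close>.\<close>

definition eff_resistance ::
    "('a \<Rightarrow> 'a \<Rightarrow> bool) \<Rightarrow> ('a \<Rightarrow> 'a \<Rightarrow> real) \<Rightarrow> 'a set \<Rightarrow> 'a set \<Rightarrow> ennreal" where
  "eff_resistance E \<mu> A B =
     inverse (Inf {energy E \<mu> f |f. (\<forall>x\<in>A. f x = 1) \<and> (\<forall>x\<in>B. f x = 0)})"

definition rho_n :: "('a \<Rightarrow> 'a \<Rightarrow> bool) \<Rightarrow> ('a \<Rightarrow> 'a \<Rightarrow> real) \<Rightarrow> 'a \<Rightarrow> nat \<Rightarrow> ennreal" where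
  "rho_n E \<mu> x n = eff_resistance E \<mu> {x} (- graph_ball E x n)"

definition rho :: "('a \<Rightarrow> 'a \<Rightarrow> bool) \<Rightarrow> ('a \<Rightarrow> 'a \<Rightarrow> real) \<Rightarrow> 'a \<Rightarrow> ennreal" where
  "rho E \<mu> x = lim (rho_n E \<mu> x)"

text \<open>
  The first disjunct is the transient case, the second the recurrent one. For \<open>n \<ge> 1\<close>, \<open>rho_n\<close> is
  increasing in \<open>n\<close> with limit \<open>rho\<close>, so all values converted by \<^const>\<open>enn2real\<close> are finite.
\<close>

definition condition_U :: "('a \<Rightarrow> 'a \<Rightarrow> bool) \<Rightarrow> ('a \<Rightarrow> 'a \<Rightarrow> real) \<Rightarrow> bool" where
  "condition_U E \<mu> \<longleftrightarrow>
     ((\<forall>x. rho E \<mu> x < \<infinity>) \<and>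
      uniform_limit UNIV (\<lambda>n x. enn2real (rho_n E \<mu> x n)) (\<lambda>x. enn2real (rho E \<mu> x)) sequentially) \<or>
     ((\<forall>x. rho E \<mu> x = \<infinity>) \<and> (\<lambda>n. INF x. rho_n E \<mu> x n) \<longlonglongrightarrow> \<infinity>)"

end

(*
  The graph is a spherically symmetric tree with unit weights in which every vertex has degree
  3 or 4, depending only on its level, and the degree is constant on extremely long blocks of
  levels. Comparing the probability of hitting z with the powers 2^(-d) and 3^(-d) of the tree
  distance d to z shows that every return probability lies between 1/3 and 1/2, and that it is close
  to 1/2 (to 1/3) deep inside blocks of degree 3 (of degree 4).

  The function h(x) = (2/3)^level(x) satisfies P h <= (17/18) h. This drift makes the walk leave
  every ball at a uniform exponential rate, so E[R_n]/n is asymptotically the average over i < n of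
  1 - F(S_i), where F is the return probability; at the end of a block almost all S_i lie deep inside
  that block. By Barta's argument the same inequality gives a spectral gap
  sum mu_x f(x)^2 <= C E(f,f); cutting a function off with 1 - d(x,.)/n then costs only a
  factor 1 + K/n in energy, which is the uniform convergence (U).
*)

theory Submission
  imports Defs
begin

section \<open>Finite-dimensional distributions of the walk\<close>

text \<open>On the \<open>D\<close>-regular tree \<open>q^d\<close>, with
  \<open>q = 1/(D - 1)\<close> and \<open>d\<close> the distance to \<open>z\<close>, is harmonic
  away from \<open>z\<close>, because
  \<open>1 + (D - 1) q^2 - D q = (1 - q) (1 - (D - 1) q)\<close>. The first step from
  \<open>z\<close> leads to distance 1, so the return probability is \<open>q\<close>: 1/2 for
  degree 3, 1/3 for degree 4. With mixed degrees the sign of this expression makes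
  \<open>2^(-d)\<close> superharmonic and \<open>3^(-d)\<close> subharmonic.

  The obstacle is the lower bounds: a subharmonic function bounds a hitting probability from below
  only if it is small wherever the walk can be after a long time without a hit. This smallness comes
  from \<open>h\<close>. Its base must exceed 1/2, both for \<open>P h < h\<close> at degree 3 and
  for \<open>h(y)/h(z)\<close> to dominate \<open>2^(-d)\<close> and \<open>3^(-d)\<close>. The base
  2/3 is a rational choice, and 17/18 is its contraction factor at degree 3.

  Since all return probabilities lie in [1/3, 1/2], the bounds 1/2 and 2/3 on
  \<open>E[R_n]/n\<close> hold at all times up to O(1/n). The blocks serve to attain them along
  subsequences.\<close>

primrec path_pmf :: "('a \<Rightarrow> 'a pmf) \<Rightarrow> nat \<Rightarrow> 'a \<Rightarrow> 'a list pmf" where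
  "path_pmf K 0 x = return_pmf [x]"
| "path_pmf K (Suc n) x = bind_pmf (K x) (\<lambda>y. map_pmf (Cons x) (path_pmf K n y))"

lemma set_path_pmf: "xs \<in> set_pmf (path_pmf K n x) \<Longrightarrow> length xs = Suc n \<and> hd xs = x"
  by (induction n arbitrary: x xs) auto

lemma finite_path_pmf:
  assumes "\<And>x. finite (set_pmf (K x))"
  shows "finite (set_pmf (path_pmf K n x))"
  by (induction n arbitrary: x) (auto simp: assms)

lemma pmf_path_pmf:
  assumes "length xs = Suc n"
  shows "pmf (path_pmf K n x) xs = indicator {x} (xs ! 0) * (\<Prod>i<n. pmf (K (xs ! i)) (xs ! Suc i))"
  using assms
proof (induction n arbitrary: x xs)
  case 0
  then obtain a where "xs = [a]" by (auto simp: length_Suc_conv)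
  then show ?case by (auto simp: indicator_def)
next
  case (Suc n)
  then obtain a ys where xs: "xs = a # ys" and len: "length ys = Suc n"
    by (auto simp: length_Suc_conv)
  let ?c = "\<Prod>i<n. pmf (K (ys ! i)) (ys ! Suc i)"
  have 1: "pmf (map_pmf (Cons x) (path_pmf K n y)) xs = indicator {x} a * (indicator {ys ! 0} y * ?c)" for y
  proof (cases "a = x")
    case True
    then have "pmf (map_pmf (Cons x) (path_pmf K n y)) xs = pmf (path_pmf K n y) ys"
      unfolding xs by (simp add: pmf_map_inj')
    with True Suc.IH[OF len, of y] show ?thesis by (auto simp: indicator_def)
  next
    case False
    then show ?thesis unfolding xs by (auto simp: pmf_eq_0_set_pmf)
  qed
  have "pmf (path_pmf K (Suc n) x) xs = indicator {x} a * (pmf (K x) (ys ! 0) * ?c)"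
    by (simp add: pmf_bind 1 measure_pmf_single)
  also have "\<dots> = indicator {x} (xs ! 0) * (\<Prod>i<Suc n. pmf (K (xs ! i)) (xs ! Suc i))"
    unfolding prod.lessThan_Suc_shift by (auto simp: xs indicator_def)
  finally show ?case .
qed

lemma expectation_path_pmf_Suc:
  fixes f :: "'a list \<Rightarrow> real"
  assumes "\<And>x. finite (set_pmf (K x))"
  shows "measure_pmf.expectation (path_pmf K (Suc n) x) f =
    measure_pmf.expectation (K x) (\<lambda>y. measure_pmf.expectation (path_pmf K n y) (\<lambda>xs. f (x # xs)))"
proof -
  have "measure_pmf.expectation (path_pmf K (Suc n) x) f =
      (\<Sum>y\<in>set_pmf (K x). pmf (K x) y *\<^sub>R measure_pmf.expectation (map_pmf (Cons x) (path_pmf K n y)) f)"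
    unfolding path_pmf.simps by (rule pmf_expectation_bind) (auto simp: assms finite_path_pmf)
  also have "\<dots> = measure_pmf.expectation (K x)
      (\<lambda>y. measure_pmf.expectation (path_pmf K n y) (\<lambda>xs. f (x # xs)))"
    by (subst integral_measure_pmf[of "set_pmf (K x)"]) (auto simp: assms)
  finally show ?thesis .
qed

lemma cylinder_sets:
  "{\<omega>. \<forall>i\<le>n. \<omega> i = s i} \<in> sets (path_law K x)"
proof -
  have "{\<omega>. \<forall>i\<le>n. \<omega> i = s i} = prod_emb UNIV (\<lambda>_. count_space UNIV) {..n} (PiE {..n} (\<lambda>i. {s i}))"
    by (auto simp: prod_emb_def space_PiM PiE_iff)
  also have "\<dots> \<in> sets (path_law K x)"
    unfolding sets_path_law by (intro sets_PiM_I) auto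
  finally show ?thesis .
qed

lemma vimage_prefix:
  "(\<lambda>\<omega> :: nat \<Rightarrow> 'a. map \<omega> [0..<Suc n]) -` {xs} = (if length xs = Suc n then {\<omega>. \<forall>i\<le>n. \<omega> i = xs ! i} else {})"
proof -
  have "map \<omega> [0..<Suc n] = xs \<longleftrightarrow> length xs = Suc n \<and> (\<forall>i\<le>n. \<omega> i = xs ! i)" for \<omega> :: "nat \<Rightarrow> 'a"
    unfolding list_eq_iff_nth_eq[of "map \<omega> [0..<Suc n]"]
    by (auto simp del: upt_Suc simp: less_Suc_eq_le)
  then show ?thesis unfolding vimage_def by (simp del: upt_Suc)
qed

lemma measurable_prefix:
  "(\<lambda>\<omega>. map \<omega> [0..<Suc n]) \<in> path_law K (x :: 'a :: countable) \<rightarrow>\<^sub>M count_space UNIV"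
  unfolding measurable_count_space_eq2_countable
  by (auto simp: space_path_law vimage_prefix cylinder_sets simp del: upt_Suc)

text \<open>Lists over a countable type form a countable space, so it suffices to compare
  singletons, where \<open>path_law_cylinder\<close> and \<open>pmf_path_pmf\<close> give the same
  product. From here on expectations are finite sums over lists.\<close>

lemma distr_prefix:
  "distr (path_law K (x :: 'a :: countable)) (count_space UNIV) (\<lambda>\<omega>. map \<omega> [0..<Suc n]) =
    measure_pmf (path_pmf K n x)"
proof (rule measure_eqI_countable[of _ UNIV])
  fix xs :: "'a list"
  have "pmf (path_pmf K n x) xs = 0" if "length xs \<noteq> Suc n"
    using set_path_pmf[of xs K n x] that by (auto simp: pmf_eq_0_set_pmf)
  then show "emeasure (distr (path_law K x) (count_space UNIV) (\<lambda>\<omega>. map \<omega> [0..<Suc n])) {xs} =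
      emeasure (measure_pmf (path_pmf K n x)) {xs}"
    by (auto simp: emeasure_distr[OF measurable_prefix] space_path_law vimage_prefix path_law_cylinder
        emeasure_pmf_single pmf_path_pmf simp del: upt_Suc)
qed auto

section \<open>Hitting probabilities and mean range by first-step analysis\<close>

text \<open>The \<open>tl\<close> drops time 0, so \<open>hit K z n z\<close> is the probability of
  a return to \<open>z\<close> within \<open>n\<close> steps.\<close>

definition hit :: "('a \<Rightarrow> 'a pmf) \<Rightarrow> 'a \<Rightarrow> nat \<Rightarrow> 'a \<Rightarrow> real" where
  "hit K z n y = measure_pmf.prob (path_pmf K n y) {xs. z \<in> set (tl xs)}"

lemma hit_0: "hit K z 0 y = 0"
  by (simp add: hit_def measure_return)

lemma hit_Suc:
  assumes fin: "\<And>x. finite (set_pmf (K x))"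
  shows "hit K z (Suc n) y = measure_pmf.expectation (K y) (\<lambda>w. if w = z then 1 else hit K z n w)"
proof -
  have *: "measure_pmf.prob (path_pmf K n w) {xs. z \<in> set xs} = (if w = z then 1 else hit K z n w)" for w
  proof -
    have "z \<in> set xs \<longleftrightarrow> w = z \<or> z \<in> set (tl xs)" if "xs \<in> set_pmf (path_pmf K n w)" for xs
      using set_path_pmf[OF that] by (cases xs) auto
    then have "measure_pmf.prob (path_pmf K n w) {xs. z \<in> set xs} =
        measure_pmf.prob (path_pmf K n w) {xs. w = z \<or> z \<in> set (tl xs)}"
      by (intro measure_pmf.finite_measure_eq_AE AE_pmfI) auto
    then show ?thesis by (auto simp: hit_def)
  qed
  have eq: "(\<lambda>xs. indicator {xs. z \<in> set (tl xs)} (y # xs) :: real) = indicator {xs. z \<in> set xs}"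
    by (auto simp: indicator_def)
  have "hit K z (Suc n) y = measure_pmf.expectation (path_pmf K (Suc n) y) (indicator {xs. z \<in> set (tl xs)} :: _ \<Rightarrow> real)"
    unfolding hit_def by simp
  also have "\<dots> = measure_pmf.expectation (K y)
      (\<lambda>w. measure_pmf.expectation (path_pmf K n w) (indicator {xs. z \<in> set xs}))"
    by (simp only: expectation_path_pmf_Suc[OF fin] eq)
  also have "\<dots> = measure_pmf.expectation (K y) (\<lambda>w. measure_pmf.prob (path_pmf K n w) {xs. z \<in> set xs})"
    by simp
  finally show ?thesis by (simp add: *)
qed

text \<open>A list drawn from \<open>path_pmf K n x\<close> has \<open>n + 1\<close> entries, so
  this is the mean of the range at time \<open>n + 1\<close>.\<close>

definition range_mean :: "('a \<Rightarrow> 'a pmf) \<Rightarrow> nat \<Rightarrow> 'a \<Rightarrow> real" where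
  "range_mean K n x = measure_pmf.expectation (path_pmf K n x) (\<lambda>xs. real (card (set xs)))"

lemma range_mean_0: "range_mean K 0 x = 1"
  by (simp add: range_mean_def)

text \<open>The starting vertex adds a point to the range of the rest of the path exactly when it is
  never revisited.\<close>

lemma range_mean_Suc:
  assumes fin: "\<And>x. finite (set_pmf (K x))"
  shows "range_mean K (Suc n) x =
    measure_pmf.expectation (K x) (range_mean K n) + (1 - hit K x (Suc n) x)"
proof -
  have int: "integrable (measure_pmf (path_pmf K m y)) (f :: _ \<Rightarrow> real)" for m y f
    by (intro integrable_measure_pmf_finite finite_path_pmf fin)
  let ?p = "path_pmf K (Suc n) x"
  have "measure_pmf.expectation ?p (\<lambda>xs. real (card (set xs))) =
      measure_pmf.expectation ?p (\<lambda>xs. real (card (set (tl xs))) + (1 - indicator {xs. x \<in> set (tl xs)} xs))"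
  proof (intro integral_cong_AE AE_pmfI)
    fix xs assume "xs \<in> set_pmf ?p"
    then obtain ys where "xs = x # ys" using set_path_pmf[of xs K "Suc n" x] by (cases xs) auto
    then show "real (card (set xs)) =
        real (card (set (tl xs))) + (1 - indicator {xs. x \<in> set (tl xs)} xs)"
      by (auto simp: card_insert_if indicator_def)
  qed auto
  also have "\<dots> = measure_pmf.expectation ?p (\<lambda>xs. real (card (set (tl xs)))) + (1 - hit K x (Suc n) x)"
    unfolding hit_def by (subst Bochner_Integration.integral_add) (auto intro!: int simp: Bochner_Integration.integral_diff[OF int int] simp del: path_pmf.simps)
  also have "measure_pmf.expectation ?p (\<lambda>xs. real (card (set (tl xs)))) =
      measure_pmf.expectation (K x) (range_mean K n)"
    by (simp only: expectation_path_pmf_Suc[OF fin]) (simp add: range_mean_def[abs_def])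
  finally show ?thesis by (simp add: range_mean_def)
qed

lemma expected_range_eq:
  "expected_range \<mu> (x :: 'a :: countable) (Suc n) = range_mean (walk_step \<mu>) n x"
proof -
  have "walk_range (Suc n) \<omega> = card (set (map \<omega> [0..<Suc n]))" for \<omega> :: "nat \<Rightarrow> 'a"
    by (simp add: walk_range_def atLeast0LessThan del: upt_Suc)
  then show ?thesis
    unfolding expected_range_def walk_law_def range_mean_def distr_prefix[symmetric]
    by (subst integral_distr[OF measurable_prefix]) auto
qed

text \<open>A return within \<open>n\<close> steps is an event of the prefix, and these events
  increase to the event of a return; continuity from below gives the limit.\<close>

lemma return_prob_LIMSEQ:
  "(\<lambda>n. hit (walk_step \<mu>) x n x) \<longlonglongrightarrow> return_prob \<mu> (x :: 'a :: countable)"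
proof -
  let ?M = "path_law (walk_step \<mu>) x"
  define A where "A n = (\<lambda>\<omega>. map \<omega> [0..<Suc n]) -` {xs. x \<in> set (tl xs)}" for n
  have A_eq: "A n = {\<omega>. \<exists>j\<ge>1. j \<le> n \<and> \<omega> j = x}" for n
    unfolding A_def by (auto simp: upt_rec[of 0] simp del: upt_Suc)
  have A_sets: "A n \<in> sets ?M" for n
    using measurable_sets[OF measurable_prefix, of "{xs. x \<in> set (tl xs)}" n "walk_step \<mu>" x]
    by (simp add: A_def space_path_law)
  have m: "measure ?M (A n) = hit (walk_step \<mu>) x n x" for n
    unfolding hit_def distr_prefix[symmetric]
    by (subst measure_distr[OF measurable_prefix]) (auto simp: A_def space_path_law)
  \<comment> \<open>The total mass of the path law is read off from its marginal at time 0.\<close>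
  have "emeasure ?M UNIV = emeasure (distr ?M (count_space UNIV) (\<lambda>\<omega>. map \<omega> [0..<Suc 0])) UNIV"
    by (subst emeasure_distr[OF measurable_prefix]) (auto simp: space_path_law)
  then have "emeasure ?M UNIV = 1"
    unfolding distr_prefix using measure_pmf.emeasure_space_1 by simp
  then interpret prob_space ?M by (intro prob_spaceI) (simp add: space_path_law)
  have "{\<omega>. return_time x \<omega> < \<infinity>} = (\<Union>n. A n)"
    unfolding A_eq return_time_def Inf_less_iff by auto
  moreover have "incseq A" unfolding A_eq by (force simp: incseq_def)
  ultimately have "(\<lambda>n. measure ?M (A n)) \<longlonglongrightarrow> measure ?M {\<omega>. return_time x \<omega> < \<infinity>}"
    using finite_Lim_measure_incseq[of A] A_sets by auto
  then show ?thesis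
    by (simp add: m return_prob_def walk_law_def space_path_law)
qed

section \<open>Spectral gap and uniform convergence of the resistances\<close>

definition nbrs :: "('a \<Rightarrow> 'a \<Rightarrow> bool) \<Rightarrow> 'a \<Rightarrow> 'a set" where
  "nbrs E x = {y. E x y}"

context weighted_graph
begin

lemma finite_nbrs: "finite (nbrs E x)"
  unfolding nbrs_def using bounded_degree by blast

lemma weight_eq_0: "\<not> E x y \<Longrightarrow> \<mu> x y = 0"
  using weight_pos_iff[of x y] weight_nonneg[of x y] by auto

lemma vertex_weight_eq: "vertex_weight \<mu> x = (\<Sum>y\<in>nbrs E x. \<mu> x y)"
  unfolding vertex_weight_def using finite_nbrs
  by (subst infsum_cong_neutral[where T = "nbrs E x" and g = "\<mu> x"]) (auto simp: weight_eq_0 nbrs_def)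

lemma nbrs_nonempty: "nbrs E x \<noteq> {}"
proof -
  obtain z where "z \<noteq> x"
    using infinite_vertices by (metis finite.emptyI finite_insert insertI1 UNIV_eq_I)
  with connected[of x z] show ?thesis
    by (auto elim: converse_rtranclpE simp: nbrs_def)
qed

lemma finite_set_walk_step: "finite (set_pmf (walk_step \<mu> x))"
  by (rule finite_subset[OF _ finite_nbrs[of x]])
    (auto simp: set_pmf_eq pmf_walk_step nbrs_def intro: ccontr[of "E _ _"] weight_eq_0)

lemma graph_dist_relpow: "(E ^^ graph_dist E x y) x y"
  unfolding graph_dist_def using connected[of x y] by (metis LeastI rtranclp_imp_relpowp)

lemma graph_dist_self: "graph_dist E x x = 0"
  unfolding graph_dist_def by (rule Least_equality) auto

lemma graph_dist_step: "E y z \<Longrightarrow> graph_dist E x z \<le> Suc (graph_dist E x y)"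
  using graph_dist_relpow[of x y] unfolding graph_dist_def[of E x z]
  by (intro Least_le) (rule relpowp_Suc_I)

lemma finite_graph_ball: "finite (graph_ball E x n)"
proof -
  have "finite {y. (E ^^ k) x y}" for k
  proof (induction k)
    case (Suc k)
    have "{y. (E ^^ Suc k) x y} = (\<Union>z\<in>{y. (E ^^ k) x y}. nbrs E z)"
      by (auto simp: nbrs_def)
    then show ?case using Suc finite_nbrs by simp
  qed auto
  moreover have "graph_ball E x n \<subseteq> (\<Union>k<n. {y. (E ^^ k) x y})"
    using graph_dist_relpow by (auto simp: graph_ball_def)
  ultimately show ?thesis by (auto intro: finite_subset)
qed

section \<open>Energies of finitely supported functions\<close>

definition edges_at :: "'a set \<Rightarrow> ('a \<times> 'a) set" where
  "edges_at B = {(x, y). E x y \<and> (x \<in> B \<or> y \<in> B)}"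

text \<open>\<open>edges_at\<close> consists of ordered pairs, so each edge occurs twice; hence the
  division by 2.\<close>

definition fin_energy :: "'a set \<Rightarrow> ('a \<Rightarrow> real) \<Rightarrow> real" where
  "fin_energy B f = (\<Sum>(x, y)\<in>edges_at B. (f x - f y)\<^sup>2 * \<mu> x y) / 2"

lemma finite_edges_at: "finite B \<Longrightarrow> finite (edges_at B)"
  by (rule finite_subset[of _ "(SIGMA x:B. nbrs E x) \<union> (\<lambda>(x, y). (y, x)) ` (SIGMA x:B. nbrs E x)"])
    (auto simp: edges_at_def nbrs_def image_iff intro: adj_sym finite_SigmaI finite_nbrs[unfolded nbrs_def])

lemma fin_energy_nonneg: "0 \<le> fin_energy B f"
  unfolding fin_energy_def by (auto intro!: sum_nonneg simp: weight_nonneg)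

lemma energy_eq:
  assumes "finite B" "\<And>x. x \<notin> B \<Longrightarrow> f x = 0"
  shows "energy E \<mu> f = ennreal (fin_energy B f)"
proof -
  have "(\<Sum>\<^sub>\<infinity>(x, y)\<in>{(x, y). E x y}. ennreal ((f x - f y)\<^sup>2 * \<mu> x y)) =
      (\<Sum>\<^sub>\<infinity>(x, y)\<in>edges_at B. ennreal ((f x - f y)\<^sup>2 * \<mu> x y))"
    using assms(2) by (intro infsum_cong_neutral) (fastforce simp: edges_at_def)+
  also have "\<dots> = (\<Sum>(x, y)\<in>edges_at B. ennreal ((f x - f y)\<^sup>2 * \<mu> x y))"
    by (rule infsum_finite) (rule finite_edges_at[OF assms(1)])
  also have "\<dots> = ennreal (\<Sum>(x, y)\<in>edges_at B. (f x - f y)\<^sup>2 * \<mu> x y)"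
    by (simp add: case_prod_unfold sum_ennreal weight_nonneg)
  finally show ?thesis
    unfolding energy_def fin_energy_def
    by (simp add: ennreal_divide_numeral sum_nonneg weight_nonneg case_prod_unfold)
qed

lemma sum_edges_at_swap:
  "(\<Sum>(x, y)\<in>edges_at B. G y x) = (\<Sum>(x, y)\<in>edges_at B. G x y)" for G :: "'a \<Rightarrow> 'a \<Rightarrow> real"
  by (rule sum.reindex_bij_witness[of _ prod.swap prod.swap])
    (auto simp: edges_at_def intro: adj_sym)

lemma sum_edges_at_fst:
  fixes G :: "'a \<Rightarrow> 'a \<Rightarrow> real"
  assumes "finite B" "\<And>x y. x \<notin> B \<Longrightarrow> G x y = 0"
  shows "(\<Sum>(x, y)\<in>edges_at B. G x y) = (\<Sum>x\<in>B. \<Sum>y\<in>nbrs E x. G x y)"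
proof -
  have "(\<Sum>(x, y)\<in>edges_at B. G x y) = (\<Sum>(x, y)\<in>(SIGMA x:B. nbrs E x). G x y)"
    using finite_edges_at[OF assms(1)] assms(2)
    by (intro sum.mono_neutral_right) (auto simp: edges_at_def nbrs_def)
  then show ?thesis
    using assms(1) finite_nbrs by (simp add: sum.Sigma)
qed

lemma sum_edges_at_square:
  assumes "finite B" "\<And>x. x \<notin> B \<Longrightarrow> f x = 0"
  shows "(\<Sum>(x, y)\<in>edges_at B. (f y)\<^sup>2 * \<mu> x y) = (\<Sum>x\<in>B. (f x)\<^sup>2 * vertex_weight \<mu> x)"
proof -
  have "(\<Sum>(x, y)\<in>edges_at B. (f y)\<^sup>2 * \<mu> x y) = (\<Sum>(x, y)\<in>edges_at B. (f x)\<^sup>2 * \<mu> x y)"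
    using sum_edges_at_swap[where B = B and G = "\<lambda>x y. (f x)\<^sup>2 * \<mu> x y"] by (simp add: weight_sym)
  also have "\<dots> = (\<Sum>x\<in>B. \<Sum>y\<in>nbrs E x. (f x)\<^sup>2 * \<mu> x y)"
    using assms by (intro sum_edges_at_fst) auto
  finally show ?thesis by (simp add: sum_distrib_left vertex_weight_eq)
qed

end

text \<open>A positive function with \<open>P h \<le> \<rho> h\<close> bounds the spectral radius of
  the walk by \<open>\<rho>\<close>.\<close>

locale contracting_weighted_graph = weighted_graph +
  fixes h :: "'a \<Rightarrow> real" and \<rho> :: real
  assumes h_pos: "0 < h x"
    and \<rho>_less_1: "\<rho> < 1"
    and contraction: "(\<Sum>y\<in>{y. E x y}. \<mu> x y * h y) \<le> \<rho> * vertex_weight \<mu> x * h x"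
begin

text \<open>
  Barta's argument: for \<open>t = h y / h x\<close> one has \<open>(a - b)\<^sup>2 \<ge> a\<^sup>2 (1 - t) + b\<^sup>2 (1 - 1 / t)\<close>.
\<close>

lemma spectral_gap:
  assumes B: "finite B" and f: "\<And>x. x \<notin> B \<Longrightarrow> f x = 0"
  shows "(1 - \<rho>) * (\<Sum>x\<in>B. (f x)\<^sup>2 * vertex_weight \<mu> x) \<le> fin_energy B f"
proof -
  \<comment> \<open>\<open>G x y\<close> is the share of the edge bound charged to \<open>x\<close>.
    Summed over the neighbours \<open>y\<close> it produces the \<open>\<mu>\<close>-weighted sum of
    \<open>h\<close> over the neighbours of \<open>x\<close>, to which \<open>contraction\<close>
    applies.\<close>
  define G where "G x y = (f x)\<^sup>2 * (1 - h y / h x) * \<mu> x y" for x y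
  have pt: "G x y + G y x \<le> (f x - f y)\<^sup>2 * \<mu> x y" for x y
  proof -
    \<comment> \<open>Since \<open>s * t = 1\<close>, expanding the square
      \<open>(f x * s - f y * t)\<^sup>2\<close> leaves exactly the cross term of
      \<open>(f x - f y)\<^sup>2\<close>.\<close>
    define s t where "s = sqrt (h y / h x)" and "t = sqrt (h x / h y)"
    have st: "s * t = 1" "s\<^sup>2 = h y / h x" "t\<^sup>2 = h x / h y"
      using h_pos[of x] h_pos[of y] by (auto simp: s_def t_def real_sqrt_mult[symmetric])
    have "(f x * s - f y * t)\<^sup>2 = (f x)\<^sup>2 * s\<^sup>2 + (f y)\<^sup>2 * t\<^sup>2 - 2 * f x * f y * (s * t)"
      by (simp add: power2_eq_square algebra_simps)
    then have "0 \<le> (f x)\<^sup>2 * (h y / h x) + (f y)\<^sup>2 * (h x / h y) - 2 * f x * f y"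
      unfolding st by (metis mult.right_neutral zero_le_power2)
    then have "(f x)\<^sup>2 * (1 - h y / h x) + (f y)\<^sup>2 * (1 - h x / h y) \<le> (f x - f y)\<^sup>2"
      by (simp add: power2_eq_square algebra_simps)
    from mult_right_mono[OF this weight_nonneg[of x y]] show ?thesis
      by (simp add: G_def weight_sym[of y x] distrib_right)
  qed
  have "(1 - \<rho>) * (\<Sum>x\<in>B. (f x)\<^sup>2 * vertex_weight \<mu> x) \<le> (\<Sum>x\<in>B. \<Sum>y\<in>nbrs E x. G x y)"
    unfolding sum_distrib_left
  proof (rule sum_mono)
    fix x
    have "(\<Sum>y\<in>nbrs E x. G x y) = (f x)\<^sup>2 * (vertex_weight \<mu> x - (\<Sum>y\<in>{y. E x y}. \<mu> x y * h y) / h x)"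
      by (simp add: G_def vertex_weight_eq nbrs_def sum_distrib_left sum_divide_distrib
          sum_subtractf[symmetric] algebra_simps)
    moreover have "(\<Sum>y\<in>{y. E x y}. \<mu> x y * h y) / h x \<le> \<rho> * vertex_weight \<mu> x"
      using contraction[of x] h_pos[of x] by (simp add: divide_le_eq)
    ultimately have "(\<Sum>y\<in>nbrs E x. G x y) \<ge> (f x)\<^sup>2 * (vertex_weight \<mu> x - \<rho> * vertex_weight \<mu> x)"
      by (simp add: mult_left_mono)
    then show "(1 - \<rho>) * ((f x)\<^sup>2 * vertex_weight \<mu> x) \<le> (\<Sum>y\<in>nbrs E x. G x y)"
      by (simp add: algebra_simps)
  qed
  also have "\<dots> = (\<Sum>(x, y)\<in>edges_at B. G x y)"
    by (rule sum_edges_at_fst[symmetric]) (auto simp: B G_def f)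
  also have "\<dots> = (\<Sum>(x, y)\<in>edges_at B. G x y + G y x) / 2"
    using sum_edges_at_swap[where B = B and G = G] by (simp add: case_prod_unfold sum.distrib)
  also have "\<dots> \<le> fin_energy B f"
    unfolding fin_energy_def using pt by (intro divide_right_mono sum_mono) auto
  finally show ?thesis .
qed

text \<open>The increment of \<open>f \<phi>\<close> splits into \<open>\<phi> x (f x - f y)\<close>
  and \<open>f y (\<phi> x - \<phi> y)\<close>. Young's inequality with parameter \<open>n\<close>
  costs a factor \<open>1 + 1/n\<close> on the first square and \<open>1 + n\<close> on the second;
  the latter carries \<open>1/n^2\<close> from the Lipschitz bound. What remains is O(1/n) times the
  weighted sum of \<open>f^2\<close>, which the spectral gap bounds by the energy.\<close>

lemma energy_cutoff:
  assumes B: "finite B" and f: "\<And>x. x \<notin> B \<Longrightarrow> f x = 0" and n: "n > 0"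
    and \<phi>: "\<And>x. \<bar>\<phi> x\<bar> \<le> 1" "\<And>x y. E x y \<Longrightarrow> \<bar>\<phi> x - \<phi> y\<bar> \<le> 1 / real n"
  shows "fin_energy B (\<lambda>x. f x * \<phi> x) \<le> (1 + (1 + 1 / (1 - \<rho>)) / real n) * fin_energy B f"
proof -
  define a where "a = real n"
  have a: "a \<ge> 1" using n by (simp add: a_def)
  have pt: "(f x * \<phi> x - f y * \<phi> y)\<^sup>2 * \<mu> x y \<le>
      (1 + 1 / a) * ((f x - f y)\<^sup>2 * \<mu> x y) + (1 + a) / a\<^sup>2 * ((f y)\<^sup>2 * \<mu> x y)"
    if "E x y" for x y
  proof -
    define u v where "u = \<phi> x * (f x - f y)" and "v = f y * (\<phi> x - \<phi> y)"
    have "0 \<le> (u / a - v)\<^sup>2 * a" using a by simp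
    also have "(u / a - v)\<^sup>2 * a = u\<^sup>2 / a + a * v\<^sup>2 - 2 * u * v"
      using a by (simp add: power2_eq_square field_simps)
    finally have "(u + v)\<^sup>2 \<le> (1 + 1 / a) * u\<^sup>2 + (1 + a) * v\<^sup>2"
      by (simp add: power2_eq_square algebra_simps)
    also have "u\<^sup>2 \<le> (f x - f y)\<^sup>2"
      using \<phi>(1)[of x] unfolding u_def power_mult_distrib
      by (intro mult_left_le_one_le) (auto simp: abs_square_le_1)
    also have "v\<^sup>2 \<le> (f y)\<^sup>2 * (1 / a\<^sup>2)"
    proof -
      have "\<bar>\<phi> x - \<phi> y\<bar>\<^sup>2 \<le> (1 / a)\<^sup>2"
        using \<phi>(2)[OF that] by (intro power_mono) (auto simp: a_def)
      then show ?thesis unfolding v_def power_mult_distrib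
        by (intro mult_left_mono) (auto simp: power_divide)
    qed
    finally have "(u + v)\<^sup>2 \<le> (1 + 1 / a) * (f x - f y)\<^sup>2 + (1 + a) * ((f y)\<^sup>2 * (1 / a\<^sup>2))"
      using a by (simp add: mult_left_mono)
    moreover have "u + v = f x * \<phi> x - f y * \<phi> y" by (simp add: u_def v_def algebra_simps)
    ultimately have "(f x * \<phi> x - f y * \<phi> y)\<^sup>2 * \<mu> x y \<le>
        ((1 + 1 / a) * (f x - f y)\<^sup>2 + (1 + a) * ((f y)\<^sup>2 * (1 / a\<^sup>2))) * \<mu> x y"
      by (intro mult_right_mono weight_nonneg) simp
    then show ?thesis by (simp add: algebra_simps)
  qed
  define Q where "Q = (\<Sum>x\<in>B. (f x)\<^sup>2 * vertex_weight \<mu> x)"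
  have Q: "(\<Sum>p\<in>edges_at B. (f (snd p))\<^sup>2 * \<mu> (fst p) (snd p)) = Q"
    using sum_edges_at_square[of B f] B f by (simp add: Q_def split_def)
  have "2 * fin_energy B (\<lambda>x. f x * \<phi> x) \<le> (\<Sum>(x, y)\<in>edges_at B.
      (1 + 1 / a) * ((f x - f y)\<^sup>2 * \<mu> x y) + (1 + a) / a\<^sup>2 * ((f y)\<^sup>2 * \<mu> x y))"
    unfolding fin_energy_def using pt by (auto intro!: sum_mono simp: edges_at_def)
  also have "\<dots> = (1 + 1 / a) * (2 * fin_energy B f) + (1 + a) / a\<^sup>2 * Q"
    by (simp add: fin_energy_def split_def sum.distrib Q[symmetric])
      (simp add: sum_distrib_left sum_divide_distrib)
  also have "(1 + a) / a\<^sup>2 * Q \<le> 2 / a * (fin_energy B f / (1 - \<rho>))"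
  proof (rule mult_mono)
    show "(1 + a) / a\<^sup>2 \<le> 2 / a" using a by (simp add: field_simps power2_eq_square)
    show "Q \<le> fin_energy B f / (1 - \<rho>)"
      using spectral_gap[OF B f] \<rho>_less_1 by (simp add: Q_def field_simps)
    show "0 \<le> Q" unfolding Q_def vertex_weight_eq
      by (auto intro!: sum_nonneg mult_nonneg_nonneg simp: weight_nonneg)
  qed (use a in auto)
  finally have *: "2 * fin_energy B (\<lambda>x. f x * \<phi> x) \<le>
      (1 + 1 / a) * (2 * fin_energy B f) + 2 / a * (fin_energy B f / (1 - \<rho>))" by simp
  define k where "k = 1 / (1 - \<rho>)"
  have "fin_energy B f / (1 - \<rho>) = fin_energy B f * k" by (simp add: k_def)
  moreover have "(1 + 1 / a) * (2 * y) + 2 / a * (y * k) = 2 * ((1 + (1 + k) / a) * y)" for y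
    using a by (simp add: field_simps)
  ultimately have "fin_energy B (\<lambda>x. f x * \<phi> x) \<le> (1 + (1 + k) / a) * fin_energy B f"
    using * by simp
  then show ?thesis by (simp add: a_def k_def)
qed

section \<open>Capacities of balls and the uniform limit\<close>

text \<open>The reciprocal of \<open>rho_n\<close>. For \<open>n = 0\<close> the ball is empty, no
  \<open>f\<close> is admissible and the infimum is infinite; hence the assumptions
  \<open>n > 0\<close> below.\<close>

definition capacity :: "'a \<Rightarrow> nat \<Rightarrow> ennreal" where
  "capacity x n = Inf {energy E \<mu> f |f. f x = 1 \<and> (\<forall>y. y \<notin> graph_ball E x n \<longrightarrow> f y = 0)}"

lemma rho_n_eq: "rho_n E \<mu> x n = inverse (capacity x n)"
  unfolding rho_n_def eff_resistance_def capacity_def by (simp add: Ball_def)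

lemma capacity_antimono: "m \<le> n \<Longrightarrow> capacity x n \<le> capacity x m"
  unfolding capacity_def by (intro Inf_superset_mono) (force simp: graph_ball_def)

lemma capacity_finite: 
  assumes "n > 0" shows "capacity x n < \<infinity>"
proof -
  have "x \<in> graph_ball E x n" using assms by (simp add: graph_ball_def graph_dist_self)
  then have "capacity x n \<le> energy E \<mu> (indicator {x})"
    unfolding capacity_def by (intro Inf_lower CollectI exI[of _ "indicator {x}"]) (auto simp: indicator_def)
  also have "\<dots> < \<infinity>" by (subst energy_eq[of "{x}"]) auto
  finally show ?thesis .
qed

text \<open>Only the term at \<open>x\<close>, where \<open>f x = 1\<close>, is kept in the spectral
  gap; \<open>vertex_weight\<close> is at least the weight of one edge.\<close>

lemma capacity_lower:
  assumes c: "c \<ge> 0" "\<And>x y. E x y \<Longrightarrow> c \<le> \<mu> x y"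
  shows "ennreal ((1 - \<rho>) * c) \<le> capacity x n"
  unfolding capacity_def
proof (safe intro!: Inf_greatest)
  fix f :: "'a \<Rightarrow> real"
  assume f: "f x = 1" "\<forall>y. y \<notin> graph_ball E x n \<longrightarrow> f y = 0"
  let ?B = "graph_ball E x n"
  have x: "x \<in> ?B" using f by force
  obtain y where y: "y \<in> nbrs E x" using nbrs_nonempty by blast
  have nn: "0 \<le> vertex_weight \<mu> z" for z
    unfolding vertex_weight_eq by (auto intro!: sum_nonneg simp: weight_nonneg)
  have "c \<le> \<mu> x y" using c y by (simp add: nbrs_def)
  also have "\<dots> \<le> vertex_weight \<mu> x"
    unfolding vertex_weight_eq by (rule member_le_sum[OF y]) (auto simp: weight_nonneg finite_nbrs)
  also have "\<dots> = (f x)\<^sup>2 * vertex_weight \<mu> x" by (simp add: f)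
  also have "\<dots> \<le> (\<Sum>z\<in>?B. (f z)\<^sup>2 * vertex_weight \<mu> z)"
    by (rule member_le_sum[OF x]) (auto simp: finite_graph_ball nn)
  finally have "(1 - \<rho>) * c \<le> (1 - \<rho>) * (\<Sum>z\<in>?B. (f z)\<^sup>2 * vertex_weight \<mu> z)"
    using \<rho>_less_1 by (intro mult_left_mono) auto
  also have "\<dots> \<le> fin_energy ?B f"
    by (rule spectral_gap) (use f in \<open>auto simp: finite_graph_ball\<close>)
  finally show "ennreal ((1 - \<rho>) * c) \<le> energy E \<mu> f"
    using f by (subst energy_eq[of ?B]) (auto simp: finite_graph_ball intro: ennreal_leI)
qed

text \<open>Any competitor for radius \<open>m\<close>, multiplied by the tent
  \<open>1 - d(x, .)/n\<close>, becomes a competitor for radius \<open>n\<close>, since the tent is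
  1 at \<open>x\<close> and 0 outside the ball. The factor depends neither on \<open>x\<close> nor
  on \<open>m\<close>.\<close>

lemma capacity_cutoff:
  assumes "n > 0"
  shows "capacity x n \<le> ennreal (1 + (1 + 1 / (1 - \<rho>)) / real n) * capacity x m"
proof -
  define C where "C = 1 + (1 + 1 / (1 - \<rho>)) / real n"
  have C: "C > 0" using \<rho>_less_1 by (simp add: C_def add_pos_nonneg)
  \<comment> \<open>With the constant on the left, the claim is a lower bound for an infimum and can
    be checked competitor by competitor.\<close>
  have "inverse (ennreal C) * capacity x n \<le> capacity x m"
    unfolding capacity_def[of x m]
  proof (safe intro!: Inf_greatest)
    fix f :: "'a \<Rightarrow> real"
    assume f: "f x = 1" "\<forall>y. y \<notin> graph_ball E x m \<longrightarrow> f y = 0"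
    let ?B = "graph_ball E x m"
    define \<phi> where "\<phi> y = max 0 (1 - real (graph_dist E x y) / real n)" for y
    have lip: "\<bar>\<phi> y - \<phi> z\<bar> \<le> 1 / real n" if "E y z" for y z
    proof -
      have "\<bar>real (graph_dist E x y) - real (graph_dist E x z)\<bar> \<le> 1"
        using graph_dist_step[OF that, of x] graph_dist_step[OF adj_sym[OF that], of x] by linarith
      then have "\<bar>real (graph_dist E x y) / real n - real (graph_dist E x z) / real n\<bar> \<le> 1 / real n"
        using assms by (simp add: diff_divide_distrib[symmetric] divide_right_mono)
      then show ?thesis unfolding \<phi>_def by linarith
    qed
    have "\<phi> y = 0" if "y \<notin> graph_ball E x n" for y
      using that assms by (simp add: \<phi>_def graph_ball_def max_def)
    then have "capacity x n \<le> energy E \<mu> (\<lambda>y. f y * \<phi> y)"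
      unfolding capacity_def by (intro Inf_lower) (auto simp: f \<phi>_def graph_dist_self)
    also have "\<dots> = ennreal (fin_energy ?B (\<lambda>y. f y * \<phi> y))"
      using f by (intro energy_eq) (auto simp: finite_graph_ball)
    also have "\<dots> \<le> ennreal (C * fin_energy ?B f)"
      unfolding C_def using f assms lip
      by (intro ennreal_leI energy_cutoff) (auto simp: finite_graph_ball \<phi>_def)
    also have "\<dots> = ennreal C * energy E \<mu> f"
      using f C fin_energy_nonneg by (subst energy_eq[of ?B]) (auto simp: finite_graph_ball ennreal_mult)
    finally have "inverse (ennreal C) * capacity x n \<le> inverse (ennreal C) * (ennreal C * energy E \<mu> f)"
      by (rule mult_left_mono) simp
    also have "\<dots> = energy E \<mu> f"
      using C by (simp add: mult.assoc[symmetric] inverse_ennreal ennreal_mult[symmetric])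
    finally show "inverse (ennreal C) * capacity x n \<le> energy E \<mu> f" .
  qed
  then have "ennreal C * (inverse (ennreal C) * capacity x n) \<le> ennreal C * capacity x m"
    by (rule mult_left_mono) simp
  then show ?thesis
    using C by (simp add: mult.assoc[symmetric] inverse_ennreal ennreal_mult[symmetric] C_def)
qed

theorem condition_U_contracting: "condition_U E \<mu>"
proof -
  obtain c where c: "c > 0" "\<And>x y. E x y \<Longrightarrow> c \<le> \<mu> x y"
    using weight_bounded_below by blast
  define \<kappa> where "\<kappa> = (1 - \<rho>) * c"
  have \<kappa>: "\<kappa> > 0" using c \<rho>_less_1 by (simp add: \<kappa>_def)
  define K where "K = 1 + 1 / (1 - \<rho>)"
  have K: "K > 0" using \<rho>_less_1 by (simp add: K_def add_pos_pos)
  define i where "i x n = enn2real (capacity x n)" for x n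
  define R where "R x n = 1 / i x n" for x n
  have cap: "capacity x n = ennreal (i x n)" if "n > 0" for x n
    using capacity_finite[OF that, of x] by (simp add: i_def)
  have i_ge: "\<kappa> \<le> i x n" if "n > 0" for x n
    using capacity_lower[of c x n, unfolded cap[OF that]] c by (simp add: \<kappa>_def i_def)
  have i_pos: "i x n > 0" if "n > 0" for x n using i_ge[OF that, of x] \<kappa> by linarith
  have rho_R: "rho_n E \<mu> x n = ennreal (R x n)" if "n > 0" for x n
    using i_pos[OF that] by (simp add: rho_n_eq cap[OF that] R_def inverse_ennreal divide_inverse)
  have R_nonneg: "0 \<le> R x n" for x n by (simp add: R_def i_def)
  have R_mono: "R x m \<le> R x n" if "0 < m" "m \<le> n" for x m n
    using capacity_antimono[OF that(2), of x] that i_pos[of m x] i_pos[of n x]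
    by (simp add: cap R_def frac_le)
  have R_le: "R x n \<le> 1 / \<kappa>" if "n > 0" for x n
    unfolding R_def using i_ge[OF that] \<kappa> by (intro divide_left_mono) (auto intro: mult_pos_pos less_le_trans)
  \<comment> \<open>The radius \<open>m\<close> may be much larger than \<open>n\<close>: letting it
    tend to infinity turns this into the rate in \<open>close\<close>, uniform in
    \<open>x\<close>.\<close>
  have R_step: "R x m \<le> R x n + K / (\<kappa> * real n)" if "0 < n" "0 < m" for x m n
  proof -
    have "ennreal (i x n) \<le> ennreal ((1 + K / real n) * i x m)"
      using capacity_cutoff[OF that(1), of x m, unfolded cap[OF that(1)] cap[OF that(2)]] K i_pos[OF that(2), of x]
      by (subst ennreal_mult) (auto simp: K_def)
    then have "i x n \<le> (1 + K / real n) * i x m"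
      using K i_pos[OF that(2), of x] by (subst (asm) ennreal_le_iff) auto
    then have "R x m \<le> (1 + K / real n) * R x n"
      using i_pos[OF that(1), of x] i_pos[OF that(2), of x] by (simp add: R_def field_simps)
    also have "\<dots> = R x n + K / real n * R x n" by (simp add: algebra_simps)
    also have "K / real n * R x n \<le> K / real n * (1 / \<kappa>)"
      using K R_le[OF that(1), of x] by (intro mult_left_mono) auto
    finally show ?thesis by (simp add: mult.commute)
  qed
  define L where "L x = lim (\<lambda>n. R x (Suc n))" for x
  have L: "(\<lambda>n. R x (Suc n)) \<longlonglongrightarrow> L x" for x
  proof -
    have "incseq (\<lambda>n. R x (Suc n))" by (intro incseq_SucI R_mono) auto
    then have "convergent (\<lambda>n. R x (Suc n))"
      by (intro Bseq_monoseq_convergent BseqI'[of _ "1 / \<kappa>"])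
        (use R_le R_nonneg in \<open>auto simp: incseq_imp_monoseq\<close>)
    then show ?thesis by (simp add: L_def convergent_LIMSEQ_iff)
  qed
  have L': "R x \<longlonglongrightarrow> L x" for x using L[of x] by (rule LIMSEQ_imp_Suc)
  have "rho_n E \<mu> x \<longlonglongrightarrow> ennreal (L x)" for x
    by (rule Lim_transform_eventually[OF tendsto_ennrealI[OF L'[of x]]])
      (auto intro!: eventually_sequentiallyI[of 1] simp: rho_R)
  then have rho: "rho E \<mu> x = ennreal (L x)" for x
    unfolding rho_def by (rule limI)
  have L_nonneg: "0 \<le> L x" for x
    by (rule LIMSEQ_le_const[OF L'[of x]]) (auto simp: R_nonneg)
  have close: "\<bar>R x n - L x\<bar> \<le> K / (\<kappa> * real n)" if "n > 0" for x n
  proof -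
    have "R x n \<le> L x"
      by (rule LIMSEQ_le_const[OF L'[of x]]) (use R_mono[OF that] in auto)
    moreover have "L x \<le> R x n + K / (\<kappa> * real n)"
      by (rule LIMSEQ_le_const2[OF L'[of x]]) (use R_step[OF that] in \<open>auto intro!: exI[of _ 1]\<close>)
    ultimately show ?thesis by simp
  qed
  have "uniform_limit UNIV (\<lambda>n x. enn2real (rho_n E \<mu> x n)) (\<lambda>x. enn2real (rho E \<mu> x)) sequentially"
  proof (rule uniform_limitI)
    fix e :: real assume "e > 0"
    have "(\<lambda>n. K / \<kappa> * (1 / real n)) \<longlonglongrightarrow> K / \<kappa> * 0"
      by (intro tendsto_intros lim_1_over_n)
    then have "eventually (\<lambda>n. K / (\<kappa> * real n) < e) sequentially"
      using \<open>e > 0\<close> order_tendstoD(2) by fastforce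
    then show "\<forall>\<^sub>F n in sequentially. \<forall>x\<in>UNIV. dist (enn2real (rho_n E \<mu> x n)) (enn2real (rho E \<mu> x)) < e"
      using eventually_gt_at_top[of 0]
    proof eventually_elim
      case (elim n)
      then show ?case
        using close[of n] R_nonneg L_nonneg by (auto simp: rho_R rho dist_real_def intro: le_less_trans)
    qed
  qed
  then show ?thesis unfolding condition_U_def by (auto simp: rho)
qed

end

section \<open>Spherically symmetric trees\<close>

text \<open>The value \<open>p r\<close> is arbitrary, hence the guards \<open>x \<noteq> r\<close>.
  The root has no parent edge, so it gets \<open>D 0\<close> children where other vertices get one
  fewer than \<open>D\<close>; all degrees are then \<open>D (lev x)\<close>.\<close>

locale level_tree =
  fixes r :: "'a :: countable" and p :: "'a \<Rightarrow> 'a" and lev :: "'a \<Rightarrow> nat" and D :: "nat \<Rightarrow> nat"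
  assumes lev_eq_0: "lev x = 0 \<longleftrightarrow> x = r"
    and lev_parent: "x \<noteq> r \<Longrightarrow> lev x = Suc (lev (p x))"
    and finite_children: "finite {y. y \<noteq> r \<and> p y = x}"
    and card_children: "card {y. y \<noteq> r \<and> p y = x} = (if x = r then D 0 else D (lev x) - 1)"
    and D_cases: "D l = 3 \<or> D l = 4"
begin

definition adj :: "'a \<Rightarrow> 'a \<Rightarrow> bool" where
  "adj x y \<longleftrightarrow> x \<noteq> r \<and> y = p x \<or> y \<noteq> r \<and> x = p y"

definition weight :: "'a \<Rightarrow> 'a \<Rightarrow> real" where
  "weight x y = of_bool (adj x y)"

definition children :: "'a \<Rightarrow> 'a set" where
  "children x = {y. y \<noteq> r \<and> p y = x}"

abbreviation nb :: "'a \<Rightarrow> 'a set" where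
  "nb \<equiv> nbrs adj"

lemma lev_root: "lev r = 0"
  by (simp add: lev_eq_0)

lemma adj_commute: "adj x y \<Longrightarrow> adj y x"
  by (auto simp: adj_def)

lemma nb_root: "nb r = children r"
  by (auto simp: nbrs_def adj_def children_def)

lemma nb_eq: "x \<noteq> r \<Longrightarrow> nb x = insert (p x) (children x)"
  by (auto simp: nbrs_def adj_def children_def)

lemma parent_notin_children: "x \<noteq> r \<Longrightarrow> p x \<notin> children x"
  using lev_parent[of x] lev_parent[of "p x"] by (auto simp: children_def)

lemma finite_nb: "finite (nb x)"
  using finite_children[of x] by (cases "x = r") (auto simp: nb_root nb_eq children_def)

lemma card_nb: "card (nb x) = D (lev x)"
proof (cases "x = r")
  case False
  then have "card (nb x) = Suc (card (children x))"
    using finite_children[of x] parent_notin_children[of x] by (simp add: nb_eq children_def)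
  then show ?thesis
    using False card_children[of x] D_cases[of "lev x"] by (auto simp: children_def)
qed (use card_children[of r] in \<open>simp add: nb_root children_def lev_root\<close>)

lemma D_ge: "3 \<le> D l" and D_le: "D l \<le> 4"
  using D_cases[of l] by auto

lemma ex_child: "\<exists>y. y \<noteq> r \<and> p y = x"
proof -
  have "card {y. y \<noteq> r \<and> p y = x} \<noteq> 0"
    unfolding card_children using D_ge[of 0] D_ge[of "lev x"] by auto
  then show ?thesis by (metis (mono_tags, lifting) card_gt_0_iff Collect_empty_eq neq0_conv)
qed

lemma ex_lev: "\<exists>x. lev x = l"
proof (induction l)
  case (Suc l)
  then obtain x y where "lev x = l" "y \<noteq> r" "p y = x" using ex_child by metis
  then show ?case using lev_parent by metis
qed (use lev_root in blast)

lemma lev_nb: "y \<in> nb x \<Longrightarrow> lev y \<le> Suc (lev x)"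
  using lev_parent[of x] lev_parent[of y] by (auto simp: nbrs_def adj_def)

lemma reach_root: "adj\<^sup>*\<^sup>* x r"
proof (induction "lev x" arbitrary: x)
  case 0
  then show ?case using lev_eq_0 by auto
next
  case (Suc n)
  then have "x \<noteq> r" using lev_root by auto
  then have "adj\<^sup>*\<^sup>* (p x) r" "adj x (p x)"
    using Suc lev_parent[of x] by (auto simp: adj_def)
  then show ?case by (meson converse_rtranclp_into_rtranclp)
qed

sublocale weighted_graph adj weight
proof
  show "infinite (UNIV :: 'a set)"
  proof
    assume "finite (UNIV :: 'a set)"
    then have "finite (range lev)" by simp
    moreover have "range lev = UNIV" using ex_lev by (metis surj_def)
    ultimately show False by simp
  qed
  show "adj\<^sup>*\<^sup>* x y" for x y
  proof -
    have sym: "symp adj\<^sup>*\<^sup>*"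
      by (rule symp_rtranclp, rule sympI, rule adj_commute)
    then show ?thesis
      using reach_root[of x] reach_root[of y] sympD[OF sym, of y r] rtranclp_trans[of adj x r y] by blast
  qed
  show "\<exists>d. \<forall>x. finite {y. adj x y} \<and> card {y. adj x y} \<le> d"
    by (rule exI[of _ 4]) (simp add: nbrs_def[symmetric] finite_nb card_nb D_le)
  show "\<not> adj x x" for x
    using lev_parent[of x] by (auto simp: adj_def)
  show "weight x y = weight y x" for x y
    using adj_commute[of x y] adj_commute[of y x] by (auto simp: weight_def)
  show "adj x y \<Longrightarrow> adj y x" for x y by (rule adj_commute)
qed (auto simp: weight_def intro: exI[of _ 1])

lemma vertex_weight: "vertex_weight weight x = real (D (lev x))"
  unfolding vertex_weight_eq
  by (simp add: nbrs_def weight_def card_nb[symmetric, unfolded nbrs_def])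

section \<open>The transition operator and its contracted function\<close>

definition avg :: "('a \<Rightarrow> real) \<Rightarrow> 'a \<Rightarrow> real" where
  "avg f x = (\<Sum>y\<in>nb x. f y) / real (D (lev x))"

lemma expectation_step: "measure_pmf.expectation (walk_step weight x) f = avg f x"
proof -
  have "measure_pmf.expectation (walk_step weight x) f = (\<Sum>y\<in>nb x. f y * pmf (walk_step weight x) y)"
    by (rule integral_measure_pmf_real)
      (use finite_nb in \<open>auto simp: set_pmf_eq pmf_walk_step weight_def nbrs_def split: if_splits\<close>)
  also have "\<dots> = avg f x"
    unfolding avg_def sum_divide_distrib
    by (rule sum.cong) (auto simp: pmf_walk_step vertex_weight weight_def nbrs_def)
  finally show ?thesis .
qed

lemma D_pos: "real (D l) > 0" using D_ge[of l] by simp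

lemma avg_mono: "(\<And>y. y \<in> nb x \<Longrightarrow> f y \<le> g y) \<Longrightarrow> avg f x \<le> avg g x"
  unfolding avg_def by (intro divide_right_mono sum_mono) auto

lemma avg_const: "avg (\<lambda>_. c) x = c"
  using D_pos[of "lev x"] by (simp add: avg_def card_nb)

lemma avg_add: "avg (\<lambda>y. f y + g y) x = avg f x + avg g x"
  by (simp add: avg_def sum.distrib add_divide_distrib)

lemma avg_diff: "avg (\<lambda>y. f y - g y) x = avg f x - avg g x"
  by (simp add: avg_def sum_subtractf diff_divide_distrib)

lemma avg_cmult: "avg (\<lambda>y. c * f y) x = c * avg f x"
  by (simp add: avg_def sum_distrib_left[symmetric])

definition h :: "'a \<Rightarrow> real" where
  "h x = (2 / 3) ^ lev x"

lemma h_pos: "h x > 0" by (simp add: h_def)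

text \<open>Away from the root the factor is \<open>(3/2 + (D - 1) * 2/3) / D\<close>, that is 17/18
  for degree 3 and 7/8 for degree 4. At the root all neighbours are children and it is 2/3.\<close>

lemma avg_h: "avg h x \<le> 17 / 18 * h x"
proof -
  have ch: "(\<Sum>y\<in>children x. h y) = real (card (children x)) * (2 / 3 * h x)"
  proof -
    have "h y = 2 / 3 * h x" if "y \<in> children x" for y
      using that lev_parent[of y] by (auto simp: children_def h_def)
    then have "(\<Sum>y\<in>children x. h y) = (\<Sum>y\<in>children x. 2 / 3 * h x)"
      by (rule sum.cong[OF refl])
    then show ?thesis by simp
  qed
  show ?thesis
  proof (cases "x = r")
    case True
    then have "avg h x = 2 / 3 * h x"
      using ch card_nb[of r] D_pos[of 0] by (simp add: avg_def nb_root lev_root)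
    then show ?thesis using h_pos[of x] by simp
  next
    case False
    have hp: "h (p x) = 3 / 2 * h x" using lev_parent[OF False] by (simp add: h_def)
    have card: "real (card (children x)) = real (D (lev x)) - 1"
      using card_children[of x] D_ge[of "lev x"] False by (simp add: children_def of_nat_diff)
    have "(\<Sum>y\<in>nb x. h y) = 3 / 2 * h x + (real (D (lev x)) - 1) * (2 / 3 * h x)"
      using False parent_notin_children[OF False] finite_children[of x] ch hp card
      by (simp add: nb_eq children_def[symmetric])
    then have "avg h x = (3 / 2 + (real (D (lev x)) - 1) * (2 / 3)) / real (D (lev x)) * h x"
      by (simp add: avg_def algebra_simps add_divide_distrib)
    then show ?thesis using D_cases[of "lev x"] h_pos[of x] by auto
  qed
qed

lemma condition_U: "condition_U adj weight"
proof -
  interpret contracting_weighted_graph adj weight h "17 / 18"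
  proof
    show "(\<Sum>y\<in>{y. adj x y}. weight x y * h y) \<le> 17 / 18 * vertex_weight weight x * h x" for x
    proof -
      have "(\<Sum>y\<in>{y. adj x y}. weight x y * h y) = (\<Sum>y\<in>nb x. h y)"
        by (auto simp: nbrs_def weight_def intro!: sum.cong)
      then show ?thesis
        using avg_h[of x] D_pos[of "lev x"]
        by (simp add: avg_def vertex_weight field_simps)
    qed
  qed (auto simp: h_pos)
  show ?thesis by (rule condition_U_contracting)
qed

section \<open>Tree distance and radial functions\<close>

text \<open>
  Deleting the root makes \<open>anc x\<close> a set of edges (each non-root vertex standing for the edge to its
  parent), so that the tree distance is the size of a symmetric difference.
\<close>

definition anc :: "'a \<Rightarrow> 'a set" where
  "anc x = (\<lambda>k. (p ^^ k) x) ` {..<lev x}"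

definition tdist :: "'a \<Rightarrow> 'a \<Rightarrow> nat" where
  "tdist x y = card (anc x - anc y) + card (anc y - anc x)"

lemma lev_ancestor: "k \<le> lev x \<Longrightarrow> lev ((p ^^ k) x) = lev x - k"
proof (induction k)
  case (Suc k)
  then have "lev ((p ^^ k) x) \<noteq> 0" by simp
  then have "(p ^^ k) x \<noteq> r" using lev_root by metis
  from lev_parent[OF this] Suc show ?case by simp
qed simp

lemma anc_root: "anc r = {}"
  by (simp add: anc_def lev_root)

lemma anc_eq:
  assumes "x \<noteq> r"
  shows "anc x = insert x (anc (p x))"
proof -
  have "anc x = (\<lambda>k. (p ^^ k) x) ` insert 0 (Suc ` {..<lev (p x)})"
    unfolding anc_def lev_parent[OF assms] lessThan_Suc_eq_insert_0 ..
  also have "\<dots> = insert x ((\<lambda>k. (p ^^ Suc k) x) ` {..<lev (p x)})"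
    by (simp add: image_image)
  also have "(\<lambda>k. (p ^^ Suc k) x) = (\<lambda>k. (p ^^ k) (p x))"
    by (simp add: funpow_Suc_right del: funpow.simps)
  finally show ?thesis by (simp add: anc_def)
qed

lemma finite_anc: "finite (anc x)"
  by (simp add: anc_def)

lemma lev_anc: "y \<in> anc x \<Longrightarrow> 0 < lev y \<and> lev y \<le> lev x"
  by (auto simp: anc_def lev_ancestor)

lemma anc_unique: "\<lbrakk>y \<in> anc x; z \<in> anc x; lev y = lev z\<rbrakk> \<Longrightarrow> y = z"
proof -
  assume "y \<in> anc x" "z \<in> anc x" and eq: "lev y = lev z"
  then obtain j k where jk: "j < lev x" "k < lev x" "y = (p ^^ j) x" "z = (p ^^ k) x"
    by (auto simp: anc_def)
  then have "lev x - j = lev x - k" using eq lev_ancestor[of j x] lev_ancestor[of k x] by simp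
  then have "j = k" using jk(1,2) by linarith
  then show ?thesis using jk by simp
qed

lemma self_notin_anc_parent: "x \<noteq> r \<Longrightarrow> x \<notin> anc (p x)"
  using lev_anc[of x "p x"] lev_parent[of x] by auto

lemma self_in_anc: "x \<noteq> r \<Longrightarrow> x \<in> anc x"
  by (simp add: anc_eq)

lemma parent_in_anc: "\<lbrakk>y \<in> anc x; p y \<noteq> r\<rbrakk> \<Longrightarrow> p y \<in> anc x"
proof -
  assume "y \<in> anc x" "p y \<noteq> r"
  then obtain k where k: "k < lev x" "y = (p ^^ k) x" by (auto simp: anc_def)
  have "y \<noteq> r" using lev_anc[OF \<open>y \<in> anc x\<close>] lev_root by auto
  then have "lev y = Suc (lev (p y))" "lev (p y) \<noteq> 0" 
    using lev_parent \<open>p y \<noteq> r\<close> lev_eq_0 by auto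
  then have "Suc k < lev x" using k lev_ancestor[of k x] by simp
  then show ?thesis unfolding anc_def using k by (auto intro!: image_eqI[of _ _ "Suc k"])
qed

lemma card_anc: "card (anc x) = lev x"
proof (induction "lev x" arbitrary: x)
  case 0
  then show ?case by (simp add: anc_def)
next
  case (Suc n)
  then have "x \<noteq> r" using lev_root by auto
  with Suc show ?case
    using lev_parent[of x] self_notin_anc_parent[of x] finite_anc by (simp add: anc_eq)
qed

lemma tdist_self: "tdist x x = 0"
  by (simp add: tdist_def)

text \<open>The level is 1-Lipschitz for \<open>tdist\<close>. This transfers information on blocks
  of levels to balls around a vertex.\<close>

lemma lev_le_tdist: "lev x \<le> lev y + tdist x y" and lev_ge_tdist: "lev y \<le> lev x + tdist x y"
proof -
  have "card (anc x) \<le> card (anc y) + card (anc x - anc y)" for x y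
    using card_mono[of "anc y \<union> (anc x - anc y)" "anc x"] card_Un_le[of "anc y" "anc x - anc y"]
    by (auto simp: finite_anc)
  from this[of x y] this[of y x]
  show "lev x \<le> lev y + tdist x y" "lev y \<le> lev x + tdist x y"
    by (auto simp: card_anc tdist_def)
qed

lemma tdist_up:
  assumes "x \<noteq> r" "x \<notin> anc z"
  shows "tdist x z = Suc (tdist (p x) z)"
proof -
  have "anc x - anc z = insert x (anc (p x) - anc z)" "anc z - anc x = anc z - anc (p x)"
    using assms by (auto simp: anc_eq)
  then show ?thesis
    using self_notin_anc_parent[OF assms(1)] finite_anc by (simp add: tdist_def)
qed

lemma tdist_down:
  assumes "x \<noteq> r" "x \<in> anc z"
  shows "tdist (p x) z = Suc (tdist x z)"
proof -
  have "anc x - anc z = anc (p x) - anc z" "anc z - anc (p x) = insert x (anc z - anc x)"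
    using assms self_notin_anc_parent[OF assms(1)] by (auto simp: anc_eq)
  moreover have "x \<notin> anc z - anc x" using self_in_anc[OF assms(1)] by simp
  ultimately show ?thesis using finite_anc by (simp add: tdist_def)
qed

lemma tdist_nb_self: "w \<in> nb z \<Longrightarrow> tdist w z = 1"
proof -
  assume w: "w \<in> nb z"
  show ?thesis
  proof (cases "w \<in> children z")
    case True
    then have "w \<noteq> r" "p w = z" by (auto simp: children_def)
    moreover have "w \<notin> anc z" using lev_anc[of w z] lev_parent[of w] \<open>p w = z\<close> \<open>w \<noteq> r\<close> by auto
    ultimately show ?thesis using tdist_up[of w z] by (simp add: tdist_self)
  next
    case False
    with w have "z \<noteq> r" "w = p z" by (auto simp: nbrs_def adj_def children_def)
    then show ?thesis using tdist_down[of z z] self_in_anc[of z] by (simp add: tdist_self)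
  qed
qed

text \<open>The closer neighbour is the child towards \<open>z\<close> if \<open>y\<close> lies on
  the branch from the root to \<open>z\<close>, and the parent otherwise. This one-step behaviour
  determines the averages of radial functions in \<open>avg_radial\<close>.\<close>

lemma tdist_nb:
  assumes "y \<noteq> z"
  shows "\<exists>w\<in>nb y. tdist y z = Suc (tdist w z) \<and> (\<forall>v\<in>nb y - {w}. tdist v z = Suc (tdist y z))"
proof (cases "y = r \<or> y \<in> anc z")
  case True
  have lev: "lev y < lev z"
  proof (cases "y = r")
    case True
    then show ?thesis using assms lev_eq_0[of z] by (simp add: lev_root)
  next
    case False
    then have y: "y \<in> anc z" using True by simp
    have "z \<noteq> r" using y anc_root by auto
    then have "lev y \<noteq> lev z" using anc_unique[OF y self_in_anc] assms by auto
    then show ?thesis using lev_anc[OF y] by simp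
  qed
  \<comment> \<open>With \<open>y = (p ^^ k) z\<close>, the child towards \<open>z\<close> is the
    ancestor reached one parent step earlier; \<open>k\<close> is positive because
    \<open>y \<noteq> z\<close>.\<close>
  have "\<exists>c. c \<in> anc z \<and> c \<in> children y"
  proof -
    obtain k where k: "k \<le> lev z" "y = (p ^^ k) z"
    proof (cases "y = r")
      case True
      then have "(p ^^ lev z) z = y" using lev_ancestor[of "lev z" z] lev_eq_0 by simp
      with that show ?thesis by blast
    next
      case False
      with True have "y \<in> anc z" by simp
      then obtain k where "k < lev z" "y = (p ^^ k) z" by (auto simp: anc_def)
      then show ?thesis using that[of k] by simp
    qed
    with assms have "k \<noteq> 0" by (cases k) auto
    then obtain j where j: "k = Suc j" by (cases k) auto
    have "(p ^^ j) z \<noteq> r" using lev_ancestor[of j z] k j lev_root by auto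
    then show ?thesis using k j by (intro exI[of _ "(p ^^ j) z"]) (auto simp: anc_def children_def)
  qed
  then obtain c where c: "c \<in> anc z" "c \<in> children y" by blast
  have "tdist v z = Suc (tdist y z)" if v: "v \<in> nb y - {c}" for v
  proof (cases "v \<in> children y")
    case True
    then have v': "v \<noteq> r" "p v = y" by (auto simp: children_def)
    have "v \<notin> anc z"
    proof
      assume "v \<in> anc z"
      moreover have "lev v = lev c" using v' c lev_parent[of v] lev_parent[of c] by (auto simp: children_def)
      ultimately show False using anc_unique c(1) v by blast
    qed
    then show ?thesis using tdist_up[of v z] v' by simp
  next
    case False
    with v have "y \<noteq> r" "v = p y" by (auto simp: nbrs_def adj_def children_def)
    then show ?thesis using True tdist_down[of y z] by simp
  qed
  moreover have "c \<in> nb y" using c(2) by (auto simp: nbrs_def adj_def children_def)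
  moreover have "tdist y z = Suc (tdist c z)"
    using tdist_down[of c z] c by (auto simp: children_def)
  ultimately show ?thesis by blast
next
  \<comment> \<open>No child of \<open>y\<close> lies on the branch to \<open>z\<close>, since
    \<open>y\<close> would then lie on it too.\<close>
  case False
  have "tdist v z = Suc (tdist y z)" if "v \<in> nb y - {p y}" for v
  proof -
    have v: "v \<noteq> r" "p v = y" using that by (auto simp: nbrs_def adj_def)
    then have "v \<notin> anc z" using parent_in_anc[of v z] False by auto
    then show ?thesis using tdist_up[of v z] v by simp
  qed
  moreover have "p y \<in> nb y" using False by (auto simp: nb_eq)
  moreover have "tdist y z = Suc (tdist (p y) z)" using tdist_up[of y z] False by simp
  ultimately show ?thesis by blast
qed

lemma avg_radial_self: "avg (\<lambda>y. g (tdist y z)) z = g 1"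
proof -
  have "(\<Sum>y\<in>nb z. g (tdist y z)) = (\<Sum>y\<in>nb z. g 1)"
    by (rule sum.cong) (auto simp: tdist_nb_self)
  then show ?thesis using D_pos[of "lev z"] by (simp add: avg_def card_nb)
qed

lemma avg_radial:
  assumes "tdist y z = Suc n"
  shows "avg (\<lambda>y. g (tdist y z)) y =
    (g n + (real (D (lev y)) - 1) * g (Suc (Suc n))) / real (D (lev y))"
proof -
  have "y \<noteq> z" using assms tdist_self by force
  then obtain w where w: "w \<in> nb y" "tdist y z = Suc (tdist w z)"
    "\<And>v. v \<in> nb y - {w} \<Longrightarrow> tdist v z = Suc (tdist y z)"
    using tdist_nb by blast
  have "(\<Sum>v\<in>nb y. g (tdist v z)) = g (tdist w z) + (\<Sum>v\<in>nb y - {w}. g (tdist v z))"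
    by (rule sum.remove) (auto simp: finite_nb w)
  also have "(\<Sum>v\<in>nb y - {w}. g (tdist v z)) = (\<Sum>v\<in>nb y - {w}. g (Suc (Suc n)))"
    by (rule sum.cong) (auto simp: w(3) assms)
  also have "\<dots> = (real (D (lev y)) - 1) * g (Suc (Suc n))"
    using D_ge[of "lev y"] w(1) finite_nb by (simp add: card_nb card_Diff_singleton of_nat_diff)
  finally show ?thesis using w(2) assms by (simp add: avg_def)
qed

end

section \<open>Return probabilities and range\<close>

text \<open>The bound is the full geometric series, \<open>1 / (1 - 17/18)\<close>.\<close>

lemma sum_power_17_18: "(\<Sum>i\<le>n. (17 / 18 :: real) ^ i) \<le> 18"
  using sum_gp_basic[of "17 / 18 :: real" n] zero_le_power[of "17 / 18 :: real" "Suc n"] by simp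

lemma sum_power_17_18_rev: "(\<Sum>i\<le>n. (17 / 18 :: real) ^ (n - i)) \<le> 18"
  using sum_power_17_18[of n] sum.nat_diff_reindex[of "\<lambda>i. (17 / 18 :: real) ^ i" "Suc n"]
  by (simp add: lessThan_Suc_atMost)

lemma liminf_real_eqI:
  fixes X :: "nat \<Rightarrow> real"
  assumes "\<And>e. e > 0 \<Longrightarrow> \<forall>\<^sub>F n in sequentially. c - e \<le> X n"
    and "\<And>e. e > 0 \<Longrightarrow> \<exists>\<^sub>F n in sequentially. X n \<le> c + e"
  shows "liminf (\<lambda>n. ereal (X n)) = ereal c"
proof -
  have le: "liminf (\<lambda>n. ereal (X n)) \<le> ereal c + ereal e" if e: "0 < e" for e
  proof (rule ccontr)
    assume "\<not> liminf (\<lambda>n. ereal (X n)) \<le> ereal c + ereal e"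
    then have "\<forall>\<^sub>F n in sequentially. ereal c + ereal e < ereal (X n)"
      using less_LiminfD not_le by blast
    then show False using assms(2)[OF e] by (simp add: frequently_def not_le)
  qed
  have ge: "ereal c \<le> liminf (\<lambda>n. ereal (X n)) + ereal e" if e: "0 < e" for e
  proof -
    have "\<forall>\<^sub>F n in sequentially. ereal (c - e) \<le> ereal (X n)"
      using assms(1)[OF e] by simp
    then have "ereal (c - e) \<le> liminf (\<lambda>n. ereal (X n))"
      by (rule Liminf_bounded)
    from add_right_mono[OF this, of "ereal e"] show ?thesis by simp
  qed
  show ?thesis
    by (rule antisym; rule ereal_le_epsilon2) (use le ge in blast)+
qed

lemma limsup_real_eqI:
  fixes X :: "nat \<Rightarrow> real"
  assumes "\<And>e. e > 0 \<Longrightarrow> \<forall>\<^sub>F n in sequentially. X n \<le> c + e"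
    and "\<And>e. e > 0 \<Longrightarrow> \<exists>\<^sub>F n in sequentially. c - e \<le> X n"
  shows "limsup (\<lambda>n. ereal (X n)) = ereal c"
proof -
  have "liminf (\<lambda>n. ereal (- X n)) = ereal (- c)"
  proof (rule liminf_real_eqI)
    fix e :: real assume e: "e > 0"
    have iff: "- c - e \<le> - X n \<longleftrightarrow> X n \<le> c + e" "- X n \<le> - c + e \<longleftrightarrow> c - e \<le> X n" for n
      by linarith+
    show "\<forall>\<^sub>F n in sequentially. - c - e \<le> - X n" "\<exists>\<^sub>F n in sequentially. - X n \<le> - c + e"
      unfolding iff by (rule assms[OF e])+
  qed
  then have "- limsup (\<lambda>n. ereal (X n)) = - ereal c"
    using ereal_Liminf_uminus[of sequentially "\<lambda>n. ereal (X n)"] by simp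
  then show ?thesis by (simp only: ereal_uminus_eq_iff)
qed

context level_tree
begin

abbreviation hits :: "'a \<Rightarrow> nat \<Rightarrow> 'a \<Rightarrow> real" where
  "hits \<equiv> hit (walk_step weight)"

abbreviation mean_range :: "nat \<Rightarrow> 'a \<Rightarrow> real" where
  "mean_range \<equiv> range_mean (walk_step weight)"

lemma hits_Suc: "hits z (Suc n) y = avg (\<lambda>w. if w = z then 1 else hits z n w) y"
  by (simp add: hit_Suc[OF finite_set_walk_step] expectation_step)

lemma hits_nonneg: "0 \<le> hits z n y"
  by (simp add: hit_def)

lemma mean_range_Suc: "mean_range (Suc n) x = avg (mean_range n) x + (1 - hits x (Suc n) x)"
  by (simp add: range_mean_Suc[OF finite_set_walk_step] expectation_step)

text \<open>
  Maximum principle for the hitting probability of \<open>z\<close>. In the lower bound, \<open>h\<close> absorbs the event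
  that the walk has neither hit \<open>z\<close> nor escaped within \<open>n\<close> steps.
\<close>

lemma hits_le:
  assumes "\<And>y. 0 \<le> v y" "1 \<le> v z" "\<And>y. y \<noteq> z \<Longrightarrow> avg v y \<le> v y"
  shows "hits z n y \<le> avg v y"
proof (induction n arbitrary: y)
  case 0
  have "avg (\<lambda>_. 0) y \<le> avg v y" by (rule avg_mono) (rule assms(1))
  then show ?case unfolding avg_const hit_0 .
next
  case (Suc n)
  show ?case unfolding hits_Suc
  proof (rule avg_mono)
    fix w
    show "(if w = z then 1 else hits z n w) \<le> v w"
    proof (cases "w = z")
      case False
      then have "hits z n w \<le> v w" using Suc[of w] assms(3)[of w] by linarith
      then show ?thesis using False by simp
    qed (use assms(2) in simp)
  qed
qed

lemma hits_ge:
  assumes "\<And>y. w y \<le> c * h y" "0 \<le> c" "w z \<le> 1" "\<And>y. y \<noteq> z \<Longrightarrow> w y \<le> avg w y"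
  shows "avg w y - c * (17 / 18) ^ Suc n * h y \<le> hits z n y"
proof (induction n arbitrary: y)
  case 0
  have "avg w y \<le> avg (\<lambda>y. c * h y) y" by (rule avg_mono) (rule assms)
  also have "\<dots> \<le> c * (17 / 18 * h y)"
    unfolding avg_cmult by (rule mult_left_mono[OF avg_h assms(2)])
  finally show ?case by (simp add: hit_0)
next
  case (Suc n)
  let ?c = "c * (17 / 18) ^ Suc n"
  have c: "0 \<le> ?c" using assms(2) by simp
  have "avg w y - c * (17 / 18) ^ Suc (Suc n) * h y = avg w y - ?c * (17 / 18 * h y)" by simp
  also have "\<dots> \<le> avg w y - ?c * avg h y"
    using mult_left_mono[OF avg_h c, of y] by simp
  also have "\<dots> = avg (\<lambda>v. w v - ?c * h v) y" by (simp only: avg_diff avg_cmult)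
  also have "\<dots> \<le> hits z (Suc n) y"
    unfolding hits_Suc
  proof (rule avg_mono)
    fix v
    have "0 \<le> ?c * h v" by (rule mult_nonneg_nonneg[OF c less_imp_le[OF h_pos]])
    moreover have "w v \<le> 1" if "v = z" using that assms(3) by simp
    moreover have "w v - ?c * h v \<le> hits z n v" if "v \<noteq> z" using Suc[of v] assms(4)[OF that] by linarith
    ultimately show "w v - ?c * h v \<le> (if v = z then 1 else hits z n v)"
      by (smt (verit))
  qed
  finally show ?case .
qed

lemma power_tdist_le_h: "(2 / 3) ^ tdist y z \<le> 1 / h z * h y"
proof -
  have "(2 / 3 :: real) ^ (lev z + tdist y z) \<le> (2 / 3) ^ lev y"
    using lev_le_tdist[of y z] by (intro power_decreasing) auto
  then show ?thesis using h_pos[of z] by (simp add: h_def power_add field_simps)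
qed

text \<open>By \<open>power_tdist_le_h\<close> the choice \<open>c = 1 / h z\<close> dominates
  \<open>g (tdist y z)\<close>. It makes the error at \<open>y = z\<close> exactly
  \<open>(17/18)^(n+1)\<close>, independent of \<open>z\<close>.\<close>

lemma hits_self_ge:
  assumes "\<And>n. g n \<le> (2 / 3) ^ n" "\<And>y. y \<noteq> z \<Longrightarrow> g (tdist y z) \<le> avg (\<lambda>y. g (tdist y z)) y"
  shows "g 1 - (17 / 18) ^ Suc n \<le> hits z n z"
proof -
  have "avg (\<lambda>y. g (tdist y z)) z - 1 / h z * (17 / 18) ^ Suc n * h z \<le> hits z n z"
    using assms(1)[of 0] assms(2) order_trans[OF assms(1) power_tdist_le_h] h_pos[of z]
    by (intro hits_ge) (auto simp: tdist_self intro: less_imp_le)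
  then show ?thesis using h_pos[of z] by (simp add: avg_radial_self)
qed

lemma avg_power:
  assumes "tdist y z = Suc n"
  shows "avg (\<lambda>y. q ^ tdist y z) y = q ^ n * ((1 + (real (D (lev y)) - 1) * q\<^sup>2) / real (D (lev y)))"
  using avg_radial[OF assms, of "\<lambda>n. q ^ n"] by (simp add: power2_eq_square algebra_simps)

lemma
  assumes "y \<noteq> z"
  shows avg_half: "avg (\<lambda>y. (1 / 2) ^ tdist y z) y \<le> (1 / 2) ^ tdist y z"
    and avg_half_eq: "D (lev y) = 3 \<Longrightarrow> avg (\<lambda>y. (1 / 2) ^ tdist y z) y = (1 / 2) ^ tdist y z"
    and avg_third: "(1 / 3) ^ tdist y z \<le> avg (\<lambda>y. (1 / 3) ^ tdist y z) y"
    and avg_third_eq: "D (lev y) = 4 \<Longrightarrow> avg (\<lambda>y. (1 / 3) ^ tdist y z) y = (1 / 3) ^ tdist y z"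
proof -
  obtain n where n: "tdist y z = Suc n" using tdist_nb[OF assms] by blast
  note * = avg_power[OF n] n power2_eq_square
  show "avg (\<lambda>y. (1 / 2) ^ tdist y z) y \<le> (1 / 2) ^ tdist y z"
    "D (lev y) = 3 \<Longrightarrow> avg (\<lambda>y. (1 / 2) ^ tdist y z) y = (1 / 2) ^ tdist y z"
    "(1 / 3) ^ tdist y z \<le> avg (\<lambda>y. (1 / 3) ^ tdist y z) y"
    "D (lev y) = 4 \<Longrightarrow> avg (\<lambda>y. (1 / 3) ^ tdist y z) y = (1 / 3) ^ tdist y z"
    unfolding * using D_cases[of "lev y"] by auto
qed

lemma hits_self_le_half: "hits z n z \<le> 1 / 2"
proof -
  have "hits z n z \<le> avg (\<lambda>y. (1 / 2) ^ tdist y z) z"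
    by (rule hits_le) (auto simp: tdist_self avg_half)
  then show ?thesis by (simp add: avg_radial_self[where g = "\<lambda>n. (1 / 2) ^ n"])
qed

lemma hits_self_ge_third: "1 / 3 - (17 / 18) ^ Suc n \<le> hits z n z"
  using hits_self_ge[of "\<lambda>n. (1 / 3) ^ n" z n] by (simp add: avg_third power_mono)

text \<open>Within distance \<open>N\<close> of \<open>z\<close> the function \<open>2^(-d)\<close>
  is harmonic. Subtracting its value at distance \<open>N\<close> and truncating at 0 keeps it
  subharmonic there and makes it vanish where the degrees are unknown.\<close>

lemma hits_self_ge_half:
  assumes "\<And>y. tdist y z < N \<Longrightarrow> D (lev y) = 3"
  shows "1 / 2 - (1 / 2) ^ N - (17 / 18) ^ Suc n \<le> hits z n z"
proof -
  define g where "g n = max 0 ((1 / 2) ^ n - (1 / 2) ^ N :: real)" for n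
  have "g 1 - (17 / 18) ^ Suc n \<le> hits z n z"
  proof (rule hits_self_ge)
    show "g n \<le> (2 / 3) ^ n" for n
    proof -
      have "(1 / 2 :: real) ^ n \<le> (2 / 3) ^ n" by (rule power_mono) auto
      moreover have "(0 :: real) \<le> (1 / 2) ^ N" "(0 :: real) \<le> (2 / 3) ^ n" by auto
      ultimately show ?thesis unfolding g_def by linarith
    qed
    fix y assume y: "y \<noteq> z"
    have 0: "0 \<le> avg (\<lambda>y. g (tdist y z)) y"
      using avg_mono[of y "\<lambda>_. 0" "\<lambda>y. g (tdist y z)"] by (simp add: avg_const g_def)
    show "g (tdist y z) \<le> avg (\<lambda>y. g (tdist y z)) y"
    proof (cases "tdist y z < N")
      case True
      have "(1 / 2) ^ tdist y z - (1 / 2) ^ N = avg (\<lambda>y. (1 / 2) ^ tdist y z - (1 / 2) ^ N) y"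
        using avg_half_eq[OF y assms[OF True]] by (simp add: avg_diff avg_const)
      also have "\<dots> \<le> avg (\<lambda>y. g (tdist y z)) y" by (rule avg_mono) (simp add: g_def)
      finally show ?thesis using 0 by (simp add: g_def)
    next
      case False
      then have "(1 / 2 :: real) ^ tdist y z \<le> (1 / 2) ^ N" by (intro power_decreasing) auto
      then show ?thesis using 0 by (simp add: g_def)
    qed
  qed
  then show ?thesis by (simp add: g_def)
qed

text \<open>A minimum of two superharmonic functions: \<open>3^(-d) + 2^(-N)\<close> is harmonic
  within distance \<open>N\<close>, while from distance \<open>N\<close> on the minimum is
  \<open>2^(-d)\<close>, which is superharmonic for both degrees.\<close>

lemma hits_self_le_third:
  assumes "\<And>y. tdist y z < N \<Longrightarrow> D (lev y) = 4"
  shows "hits z n z \<le> 1 / 3 + (1 / 2) ^ N"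
proof -
  define g where "g n = min ((1 / 3) ^ n + (1 / 2) ^ N) ((1 / 2) ^ n :: real)" for n
  have "hits z n z \<le> avg (\<lambda>y. g (tdist y z)) z"
  proof (rule hits_le)
    fix y assume y: "y \<noteq> z"
    have half: "avg (\<lambda>y. g (tdist y z)) y \<le> (1 / 2) ^ tdist y z"
      by (rule order_trans[OF avg_mono avg_half[OF y]]) (simp add: g_def)
    show "avg (\<lambda>y. g (tdist y z)) y \<le> g (tdist y z)"
    proof (cases "tdist y z < N")
      case True
      have "avg (\<lambda>y. g (tdist y z)) y \<le> avg (\<lambda>y. (1 / 3) ^ tdist y z + (1 / 2) ^ N) y"
        by (rule avg_mono) (simp add: g_def)
      also have "\<dots> = (1 / 3) ^ tdist y z + (1 / 2) ^ N"
        using avg_third_eq[OF y assms[OF True]] by (simp add: avg_add avg_const)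
      finally show ?thesis using half by (simp add: g_def)
    next
      case False
      then have "(1 / 2 :: real) ^ tdist y z \<le> (1 / 2) ^ N" by (intro power_decreasing) auto
      then have "g (tdist y z) = (1 / 2) ^ tdist y z"
        unfolding g_def using zero_le_power[of "1 / 3 :: real" "tdist y z"] by linarith
      then show ?thesis using half by simp
    qed
  qed (auto simp: g_def tdist_self)
  then show ?thesis unfolding avg_radial_self[of g] by (simp add: g_def)
qed

lemma return_prob_ge: "1 / 3 \<le> return_prob weight z" and return_prob_le: "return_prob weight z \<le> 1 / 2"
  and return_prob_ge_half:
    "(\<And>y. tdist y z < N \<Longrightarrow> D (lev y) = 3) \<Longrightarrow> 1 / 2 - (1 / 2) ^ N \<le> return_prob weight z"
  and return_prob_le_third:
    "(\<And>y. tdist y z < N \<Longrightarrow> D (lev y) = 4) \<Longrightarrow> return_prob weight z \<le> 1 / 3 + (1 / 2) ^ N"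
proof -
  note lim = return_prob_LIMSEQ[of weight z]
  have ge: "c \<le> return_prob weight z" if "\<And>n. c - (17 / 18) ^ Suc n \<le> hits z n z" for c
  proof -
    have "(\<lambda>n. c - (17 / 18) ^ Suc n) \<longlonglongrightarrow> c - 0"
      by (intro tendsto_intros LIMSEQ_Suc LIMSEQ_realpow_zero) auto
    then show ?thesis using LIMSEQ_le[OF _ lim] that by auto
  qed
  show "1 / 3 \<le> return_prob weight z" by (rule ge) (rule hits_self_ge_third)
  show "return_prob weight z \<le> 1 / 2"
    by (rule LIMSEQ_le_const2[OF lim]) (use hits_self_le_half in blast)
  show "1 / 2 - (1 / 2) ^ N \<le> return_prob weight z" if "\<And>y. tdist y z < N \<Longrightarrow> D (lev y) = 3"
    by (rule ge) (rule hits_self_ge_half[OF that])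
  show "return_prob weight z \<le> 1 / 3 + (1 / 2) ^ N" if "\<And>y. tdist y z < N \<Longrightarrow> D (lev y) = 4"
    by (rule LIMSEQ_le_const2[OF lim]) (auto intro: hits_self_le_third[OF that])
qed

section \<open>Mean range from bounds on finite-time return probabilities\<close>

lemma avg_minus: "avg (\<lambda>y. - f y) x = - avg f x"
  by (simp add: avg_def sum_negf)

lemma avg_sum: "avg (\<lambda>y. \<Sum>i\<in>A. f i y) x = (\<Sum>i\<in>A. avg (f i) x)"
  unfolding avg_def by (subst sum.swap) (simp add: sum_divide_distrib)

text \<open>A time \<open>i \<le> n\<close> is counted for the range if it is the last visit to \<open>S\<^sub>i\<close> up to time \<open>n\<close>.\<close>

lemma mean_range_eq: "mean_range n x = (\<Sum>i\<le>n. (avg ^^ i) (\<lambda>y. 1 - hits y (n - i) y) x)"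
proof (induction n arbitrary: x)
  case 0
  then show ?case by (simp add: range_mean_0 hit_0)
next
  case (Suc n)
  have "mean_range n = (\<lambda>y. \<Sum>i\<le>n. (avg ^^ i) (\<lambda>y. 1 - hits y (n - i) y) y)"
    using Suc by blast
  then show ?case
    unfolding mean_range_Suc sum.atMost_Suc_shift by (simp add: avg_sum)
qed

text \<open>In \<open>i\<close> steps the level rises by at most \<open>i\<close>, so
  \<open>f\<close> has to be controlled only up to that level; each step multiplies the
  \<open>h\<close> part by 17/18.\<close>

lemma iterate_avg_le:
  assumes "0 \<le> a" "\<And>x. lev x \<le> lev y + i \<Longrightarrow> f x \<le> c + a * h x"
  shows "(avg ^^ i) f y \<le> c + a * (17 / 18) ^ i * h y"
  using assms(2)
proof (induction i arbitrary: y)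
  case (Suc i)
  have "(avg ^^ Suc i) f y = avg ((avg ^^ i) f) y" by simp
  also have "\<dots> \<le> avg (\<lambda>w. c + a * (17 / 18) ^ i * h w) y"
  proof (rule avg_mono)
    fix w assume "w \<in> nb y"
    from lev_nb[OF this] show "(avg ^^ i) f w \<le> c + a * (17 / 18) ^ i * h w"
      by (intro Suc.IH Suc.prems) simp
  qed
  also have "\<dots> = c + a * (17 / 18) ^ i * avg h y" by (simp only: avg_add avg_const avg_cmult)
  also have "\<dots> \<le> c + a * (17 / 18) ^ i * (17 / 18 * h y)"
    using avg_h[of y] assms(1) by (intro add_left_mono mult_left_mono) auto
  finally show ?case by simp
qed simp

lemma iterate_avg_ge:
  assumes "0 \<le> a" "\<And>x. lev x \<le> lev y + i \<Longrightarrow> c - a * h x \<le> f x"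
  shows "c - a * (17 / 18) ^ i * h y \<le> (avg ^^ i) f y"
proof -
  have neg: "(avg ^^ i) (\<lambda>x. - f x) y = - (avg ^^ i) f y" for i y
  proof (induction i arbitrary: y)
    case (Suc i)
    then have "(avg ^^ i) (\<lambda>x. - f x) = (\<lambda>x. - (avg ^^ i) f x)" by blast
    then show ?case by (simp add: avg_minus)
  qed simp
  have "(avg ^^ i) (\<lambda>x. - f x) y \<le> - c + a * (17 / 18) ^ i * h y"
    using assms(2) by (intro iterate_avg_le[OF assms(1)]) force
  then show ?thesis unfolding neg by simp
qed

text \<open>Two errors are allowed: \<open>(17/18)^m\<close> for a remaining horizon of only
  \<open>m\<close> steps, and \<open>a * h x\<close> for vertices where the comparison fails. Both
  become geometric in time and sum to at most 18 and \<open>18 * a\<close>.\<close>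

lemma mean_range_le:
  assumes "0 \<le> a" "\<And>x m. lev x \<le> n \<Longrightarrow> 1 - hits x m x \<le> c + (17 / 18) ^ m + a * h x"
  shows "mean_range n r \<le> c * real (Suc n) + 18 * (1 + a)"
proof -
  have "mean_range n r \<le> (\<Sum>i\<le>n. c + (17 / 18) ^ (n - i) + a * (17 / 18) ^ i)"
    unfolding mean_range_eq
  proof (rule sum_mono)
    fix i assume "i \<in> {..n}"
    then show "(avg ^^ i) (\<lambda>y. 1 - hits y (n - i) y) r \<le> c + (17 / 18) ^ (n - i) + a * (17 / 18) ^ i"
      using iterate_avg_le[of a r i "\<lambda>y. 1 - hits y (n - i) y" "c + (17 / 18) ^ (n - i)"] assms
      by (simp add: lev_root h_def)
  qed
  also have "\<dots> = c * real (Suc n) + (\<Sum>i\<le>n. (17 / 18) ^ (n - i)) + a * (\<Sum>i\<le>n. (17 / 18) ^ i)"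
    by (simp add: sum.distrib sum_distrib_left)
  also have "\<dots> \<le> c * real (Suc n) + 18 + a * 18"
    using sum_power_17_18 sum_power_17_18_rev assms(1) by (intro add_mono mult_left_mono order_refl) auto
  finally show ?thesis by simp
qed

lemma mean_range_ge:
  assumes "0 \<le> a" "\<And>x m. lev x \<le> n \<Longrightarrow> c - a * h x \<le> 1 - hits x m x"
  shows "c * real (Suc n) - 18 * a \<le> mean_range n r"
proof -
  have "c * real (Suc n) - a * 18 \<le> c * real (Suc n) - a * (\<Sum>i\<le>n. (17 / 18) ^ i)"
    using sum_power_17_18 assms(1) by (intro diff_left_mono mult_left_mono) auto
  also have "\<dots> = (\<Sum>i\<le>n. c - a * (17 / 18) ^ i)"
    by (simp add: sum_subtractf sum_distrib_left)
  also have "\<dots> \<le> mean_range n r"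
    unfolding mean_range_eq
  proof (rule sum_mono)
    fix i assume "i \<in> {..n}"
    then show "c - a * (17 / 18) ^ i \<le> (avg ^^ i) (\<lambda>y. 1 - hits y (n - i) y) r"
      using iterate_avg_ge[of a r i c "\<lambda>y. 1 - hits y (n - i) y"] assms
      by (simp add: lev_root h_def)
  qed
  finally show ?thesis by simp
qed

lemma block_interior:
  assumes "\<And>l. m \<le> l \<Longrightarrow> l \<le> n + N \<Longrightarrow> D l = d" "m + N \<le> lev z" "lev z \<le> n" "tdist y z < N"
  shows "D (lev y) = d"
  using lev_le_tdist[of y z] lev_ge_tdist[of z y] assms(2-4) by (intro assms(1)) auto

lemma h_ge_one: "lev x \<le> k \<Longrightarrow> 1 \<le> (3 / 2) ^ k * h x"
proof -
  assume "lev x \<le> k"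
  then have "(2 / 3 :: real) ^ k \<le> h x" unfolding h_def by (intro power_decreasing) auto
  then have "(3 / 2) ^ k * (2 / 3 :: real) ^ k \<le> (3 / 2) ^ k * h x" by (intro mult_left_mono) auto
  then show ?thesis by (simp add: power_mult_distrib[symmetric])
qed

text \<open>By time \<open>n\<close> the walk from the root stays at levels up to \<open>n\<close>,
  so it leaves the block interior only below level \<open>m + N\<close>. There the trivial bound 1
  is at most \<open>(3/2)^(m+N) * h x\<close>; this charges at most \<open>18 * (3/2)^(m+N)\<close>
  to all visits at those low levels.\<close>

lemma mean_range_block_3:
  assumes "\<And>l. m \<le> l \<Longrightarrow> l \<le> n + N \<Longrightarrow> D l = 3"
  shows "mean_range n r \<le> (1 / 2 + (1 / 2) ^ N) * real (Suc n) + 18 * (1 + (3 / 2) ^ (m + N))"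
proof (rule mean_range_le)
  fix x k assume x: "lev x \<le> n"
  show "1 - hits x k x \<le> 1 / 2 + (1 / 2) ^ N + (17 / 18) ^ k + (3 / 2) ^ (m + N) * h x"
  proof (cases "m + N \<le> lev x")
    case True
    have "1 / 2 - (1 / 2) ^ N - (17 / 18) ^ Suc k \<le> hits x k x"
      by (rule hits_self_ge_half) (rule block_interior[OF assms True x])
    moreover have "(17 / 18 :: real) ^ Suc k \<le> (17 / 18) ^ k" by (rule power_decreasing) auto
    moreover have "0 \<le> (3 / 2) ^ (m + N) * h x" using h_pos[of x] by simp
    ultimately show ?thesis by linarith
  next
    case False
    then have "1 \<le> (3 / 2) ^ (m + N) * h x" by (intro h_ge_one) simp
    moreover have "(0 :: real) \<le> (1 / 2) ^ N" "(0 :: real) \<le> (17 / 18) ^ k" by auto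
    ultimately show ?thesis using hits_nonneg[of x k x] by linarith
  qed
qed simp

lemma mean_range_block_4:
  assumes "\<And>l. m \<le> l \<Longrightarrow> l \<le> n + N \<Longrightarrow> D l = 4"
  shows "(2 / 3 - (1 / 2) ^ N) * real (Suc n) - 18 * (3 / 2) ^ (m + N) \<le> mean_range n r"
proof (rule mean_range_ge)
  fix x k assume x: "lev x \<le> n"
  show "2 / 3 - (1 / 2) ^ N - (3 / 2) ^ (m + N) * h x \<le> 1 - hits x k x"
  proof (cases "m + N \<le> lev x")
    case True
    have "hits x k x \<le> 1 / 3 + (1 / 2) ^ N"
      by (rule hits_self_le_third) (rule block_interior[OF assms True x])
    moreover have "0 \<le> (3 / 2) ^ (m + N) * h x" using h_pos[of x] by simp
    ultimately show ?thesis by linarith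
  next
    case False
    then have "1 \<le> (3 / 2) ^ (m + N) * h x" by (intro h_ge_one) simp
    moreover have "(0 :: real) \<le> (1 / 2) ^ N" by auto
    ultimately show ?thesis using hits_self_le_half[of x k] by linarith
  qed
qed simp

end

section \<open>Extremal return probabilities and the two limits\<close>

text \<open>The inequality makes the additive error of \<open>mean_range_block_3\<close> and
  \<open>mean_range_block_4\<close> at most \<open>1/(N+1)\<close> after division by
  \<open>n + 1\<close>. Degrees are prescribed up to level \<open>n + N\<close> so that
  \<open>N\<close>-balls around vertices of level at most \<open>n\<close> do not leave the
  block.\<close>

locale block_tree = level_tree +
  assumes blocks: "d = 3 \<or> d = 4 \<Longrightarrow> \<exists>m n. m + N \<le> n \<and>
    real (Suc N) * (18 * (1 + (3 / 2) ^ (m + N))) \<le> real (Suc n) \<and>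
    (\<forall>l. m \<le> l \<longrightarrow> l \<le> n + N \<longrightarrow> D l = d)"
begin

lemma block_vertex:
  assumes "d = 3 \<or> d = 4"
  obtains z where "\<And>y. tdist y z < N \<Longrightarrow> D (lev y) = d"
proof -
  obtain m n where mn: "m + N \<le> n" "\<forall>l. m \<le> l \<longrightarrow> l \<le> n + N \<longrightarrow> D l = d"
    using blocks[OF assms, of N] by blast
  obtain z where "lev z = m + N" using ex_lev by blast
  with mn that show ?thesis using block_interior[of m n N d z] by auto
qed

lemma half_power_small:
  assumes "(e :: real) > 0"
  shows "\<forall>\<^sub>F N in sequentially. (1 / 2) ^ N + 1 / real (Suc N) < e"
proof -
  have "(\<lambda>N. (1 / 2 :: real) ^ N + 1 / real (Suc N)) \<longlonglongrightarrow> 0 + 0"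
    by (intro tendsto_add LIMSEQ_realpow_zero LIMSEQ_Suc[OF lim_1_over_n]) auto
  then show ?thesis using assms by (auto dest: order_tendstoD(2))
qed

lemma F1_eq: "F1 weight = 1 / 3"
proof (rule antisym)
  have bdd: "bdd_below (range (return_prob weight))"
    using return_prob_ge by (intro bdd_belowI[of _ "1 / 3"]) auto
  show "F1 weight \<le> 1 / 3"
  proof (rule field_le_epsilon)
    fix e :: real assume "e > 0"
    from eventually_happens[OF half_power_small[OF this]]
    obtain N where N: "(1 / 2) ^ N + 1 / real (Suc N) < e" by auto
    obtain z where "\<And>y. tdist y z < N \<Longrightarrow> D (lev y) = 4" using block_vertex[of 4 N] by blast
    then have "return_prob weight z \<le> 1 / 3 + (1 / 2) ^ N" by (rule return_prob_le_third)
    also have "\<dots> \<le> 1 / 3 + e"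
    proof -
      have "0 < 1 / real (Suc N)" by simp
      then show ?thesis using N by linarith
    qed
    finally show "F1 weight \<le> 1 / 3 + e"
      unfolding F1_def using cINF_lower[OF bdd, of z] by simp
  qed
  show "1 / 3 \<le> F1 weight"
    unfolding F1_def by (rule cINF_greatest[OF UNIV_not_empty return_prob_ge])
qed

lemma F2_eq: "F2 weight = 1 / 2"
proof (rule antisym)
  have bdd: "bdd_above (range (return_prob weight))"
    using return_prob_le by (intro bdd_aboveI[of _ "1 / 2"]) auto
  show "1 / 2 \<le> F2 weight"
  proof (rule field_le_epsilon)
    fix e :: real assume "e > 0"
    from eventually_happens[OF half_power_small[OF this]]
    obtain N where N: "(1 / 2) ^ N + 1 / real (Suc N) < e" by auto
    obtain z where "\<And>y. tdist y z < N \<Longrightarrow> D (lev y) = 3" using block_vertex[of 3 N] by blast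
    then have "1 / 2 - (1 / 2) ^ N \<le> return_prob weight z" by (rule return_prob_ge_half)
    also have "\<dots> \<le> F2 weight" unfolding F2_def by (rule cSUP_upper[OF _ bdd]) simp
    finally have "1 / 2 \<le> F2 weight + (1 / 2) ^ N" by simp
    moreover have "0 < 1 / real (Suc N)" by simp
    ultimately show "1 / 2 \<le> F2 weight + e" using N by linarith
  qed
  show "F2 weight \<le> 1 / 2"
    unfolding F2_def by (rule cSUP_least[OF UNIV_not_empty return_prob_le])
qed

text \<open>The block chosen for \<open>N\<close> satisfies \<open>n \<ge> N\<close>, so large
  \<open>N\<close> yields arbitrarily late times.\<close>

lemma block_times:
  assumes "d = 3 \<or> d = 4" "\<forall>\<^sub>F N in sequentially. P N"
    "\<And>N m n. \<lbrakk>P N; real (Suc N) * (18 * (1 + (3 / 2) ^ (m + N))) \<le> real (Suc n);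
      \<And>l. m \<le> l \<Longrightarrow> l \<le> n + N \<Longrightarrow> D l = d\<rbrakk> \<Longrightarrow> Q (Suc n)"
  shows "\<exists>\<^sub>F n in sequentially. Q n"
  unfolding frequently_sequentially
proof
  fix k
  have "\<forall>\<^sub>F N in sequentially. P N \<and> k \<le> N"
    using assms(2) eventually_ge_at_top[of k] by eventually_elim simp
  then obtain N where N: "P N" "k \<le> N" using eventually_happens by fastforce
  obtain m n where mn: "m + N \<le> n" "real (Suc N) * (18 * (1 + (3 / 2) ^ (m + N))) \<le> real (Suc n)"
    "\<forall>l. m \<le> l \<longrightarrow> l \<le> n + N \<longrightarrow> D l = d"
    using blocks[OF assms(1), of N] by blast
  then have "Q (Suc n)" using assms(3)[OF N(1) mn(2)] by blast
  then show "\<exists>n\<ge>k. Q n" using mn(1) N(2) by (intro exI[of _ "Suc n"]) auto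
qed

lemma liminf_range: "liminf (\<lambda>n. ereal (expected_range weight r n / real n)) = ereal (1 / 2)"
proof (rule liminf_real_eqI)
  fix e :: real assume e: "e > 0"
  show "\<forall>\<^sub>F n in sequentially. 1 / 2 - e \<le> expected_range weight r n / real n"
    using eventually_gt_at_top[of 0]
  proof eventually_elim
    case (elim n)
    then obtain k where n: "n = Suc k" by (cases n) auto
    \<comment> \<open>Taking \<open>a = 0\<close> is possible because return probabilities are at
      most 1/2 for every finite horizon.\<close>
    have "1 / 2 * real (Suc k) - 18 * 0 \<le> mean_range k r"
      using hits_self_le_half by (intro mean_range_ge) (auto simp: field_simps)
    then have "1 / 2 \<le> expected_range weight r n / real n"
      unfolding n expected_range_eq by (simp add: field_simps)
    then show ?case using e by linarith
  qed
  show "\<exists>\<^sub>F n in sequentially. expected_range weight r n / real n \<le> 1 / 2 + e"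
  proof (rule block_times[OF _ half_power_small[OF e]])
    fix N m n
    assume *: "(1 / 2) ^ N + 1 / real (Suc N) < e"
      "real (Suc N) * (18 * (1 + (3 / 2) ^ (m + N))) \<le> real (Suc n)"
      "\<And>l. m \<le> l \<Longrightarrow> l \<le> n + N \<Longrightarrow> D l = 3"
    have "18 * (1 + (3 / 2) ^ (m + N)) \<le> 1 / real (Suc N) * real (Suc n)"
      using *(2) by (simp add: field_simps)
    then have "mean_range n r \<le> (1 / 2 + ((1 / 2) ^ N + 1 / real (Suc N))) * real (Suc n)"
      using mean_range_block_3[of m n N, OF *(3)] unfolding distrib_right by linarith
    also have "\<dots> \<le> (1 / 2 + e) * real (Suc n)"
      using *(1) by (intro mult_right_mono) auto
    finally show "expected_range weight r (Suc n) / real (Suc n) \<le> 1 / 2 + e"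
      unfolding expected_range_eq by (subst pos_divide_le_eq) auto
  qed simp
qed

lemma limsup_range: "limsup (\<lambda>n. ereal (expected_range weight r n / real n)) = ereal (2 / 3)"
proof (rule limsup_real_eqI)
  fix e :: real assume e: "e > 0"
  have "(\<lambda>n. 18 * (1 / real n)) \<longlonglongrightarrow> 18 * 0"
    by (intro tendsto_intros lim_1_over_n)
  from order_tendstoD(2)[OF this, of e] e
  have "\<forall>\<^sub>F n in sequentially. 18 * (1 / real n) < e" by simp
  then show "\<forall>\<^sub>F n in sequentially. expected_range weight r n / real n \<le> 2 / 3 + e"
    using eventually_gt_at_top[of 0]
  proof eventually_elim
    case (elim n)
    then obtain k where n: "n = Suc k" by (cases n) auto
    \<comment> \<open>Again \<open>a = 0\<close>, but the finite horizon costs the additive constant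
      18, which disappears after division by \<open>n\<close>.\<close>
    have "mean_range k r \<le> 2 / 3 * real (Suc k) + 18 * (1 + 0)"
    proof (rule mean_range_le)
      fix x m
      have "(17 / 18 :: real) ^ Suc m \<le> (17 / 18) ^ m" by (rule power_decreasing) auto
      then show "1 - hits x m x \<le> 2 / 3 + (17 / 18) ^ m + 0 * h x"
        using hits_self_ge_third[of m x] by linarith
    qed simp
    from divide_right_mono[OF this, of "real (Suc k)"]
    have "expected_range weight r n / real n \<le> 2 / 3 + 18 * (1 / real n)"
      unfolding n expected_range_eq by (simp add: add_divide_distrib del: of_nat_Suc)
    then show ?case using elim by simp
  qed
  show "\<exists>\<^sub>F n in sequentially. 2 / 3 - e \<le> expected_range weight r n / real n"
  proof (rule block_times[OF _ half_power_small[OF e]])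
    fix N m n
    assume *: "(1 / 2) ^ N + 1 / real (Suc N) < e"
      "real (Suc N) * (18 * (1 + (3 / 2) ^ (m + N))) \<le> real (Suc n)"
      "\<And>l. m \<le> l \<Longrightarrow> l \<le> n + N \<Longrightarrow> D l = 4"
    have "18 * (1 + (3 / 2) ^ (m + N)) \<le> 1 / real (Suc N) * real (Suc n)"
      using *(2) by (simp add: field_simps)
    then have le: "18 * (3 / 2) ^ (m + N) \<le> 1 / real (Suc N) * real (Suc n)" by simp
    have "(2 / 3 - e) * real (Suc n) \<le> (2 / 3 - ((1 / 2) ^ N + 1 / real (Suc N))) * real (Suc n)"
      using *(1) by (intro mult_right_mono) auto
    also have "\<dots> \<le> mean_range n r"
      using mean_range_block_4[of m n N, OF *(3)] le unfolding left_diff_distrib distrib_right by linarith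
    finally show "2 / 3 - e \<le> expected_range weight r (Suc n) / real (Suc n)"
      unfolding expected_range_eq by (subst pos_le_divide_eq) auto
  qed simp
qed

end

section \<open>Construction of the tree\<close>

text \<open>Vertices are lists of child indices, most recent step first; the parent map is \<open>tl\<close>.\<close>

inductive_set tree_paths :: "(nat \<Rightarrow> nat) \<Rightarrow> nat list set" for c where
  Nil: "[] \<in> tree_paths c"
| Cons: "xs \<in> tree_paths c \<Longrightarrow> k < c (length xs) \<Longrightarrow> k # xs \<in> tree_paths c"

lemma tree_paths_Cons_iff: "k # xs \<in> tree_paths c \<longleftrightarrow> xs \<in> tree_paths c \<and> k < c (length xs)"
  by (subst tree_paths.simps) simp

lemma infinite_tree_paths:
  assumes "\<And>l. c l > 0"
  shows "infinite (tree_paths c)"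
proof
  have "replicate n 0 \<in> tree_paths c" for n
    by (induction n) (auto intro: tree_paths.intros assms)
  then have "n \<in> length ` tree_paths c" for n
    by (intro image_eqI[of _ _ "replicate n 0"]) auto
  then have "UNIV = length ` tree_paths c" by blast
  moreover assume "finite (tree_paths c)"
  ultimately show False by (metis finite_imageI infinite_UNIV_nat)
qed

text \<open>The paths form a countably infinite set, so they are transported to \<open>nat\<close>
  by a bijection. Counting children becomes counting the indices that may be prepended to a
  path.\<close>

lemma ex_tree:
  fixes D :: "nat \<Rightarrow> nat"
  assumes D: "\<And>l. D l = 3 \<or> D l = 4"
  shows "\<exists>(r :: nat) p lev. level_tree r p lev D"
proof -
  define c where "c l = (if l = 0 then D 0 else D l - 1)" for l
  let ?V = "tree_paths c"
  have c_pos: "c l > 0" for l using D[of l] D[of 0] by (auto simp: c_def)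
  define enc where "enc = to_nat_on ?V"
  define dec where "dec = from_nat_into ?V"
  have bij: "bij_betw enc ?V UNIV"
    unfolding enc_def by (rule to_nat_on_infinite) (auto simp: infinite_tree_paths c_pos)
  have dec_enc: "dec (enc xs) = xs" if "xs \<in> ?V" for xs
    unfolding enc_def dec_def by (rule from_nat_into_to_nat_on) (auto simp: that)
  have dec: "dec n \<in> ?V" and enc_dec: "enc (dec n) = n" for n
  proof -
    obtain xs where "xs \<in> ?V" "n = enc xs" using bij by (force simp: bij_betw_def)
    then show "dec n \<in> ?V" "enc (dec n) = n" by (auto simp: dec_enc)
  qed
  have tl: "tl xs \<in> ?V" if "xs \<in> ?V" for xs
    using that by (cases xs) (auto simp: tree_paths_Cons_iff intro: tree_paths.Nil)
  have root: "n = enc [] \<longleftrightarrow> dec n = []" for n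
    using dec_enc[OF tree_paths.Nil] enc_dec by metis
  have children: "{y. y \<noteq> enc [] \<and> enc (tl (dec y)) = x} = (\<lambda>k. enc (k # dec x)) ` {..<c (length (dec x))}"
    for x
  proof (intro equalityI subsetI)
    fix y assume "y \<in> {y. y \<noteq> enc [] \<and> enc (tl (dec y)) = x}"
    then have y: "dec y \<noteq> []" "dec x = tl (dec y)" using root dec_enc[OF tl[OF dec]] by auto
    then obtain k where k: "dec y = k # dec x" by (cases "dec y") auto
    then have "k < c (length (dec x))" using dec[of y] by (simp add: tree_paths_Cons_iff)
    then show "y \<in> (\<lambda>k. enc (k # dec x)) ` {..<c (length (dec x))}"
      using k enc_dec[of y] by (intro image_eqI[of _ _ k]) auto
  next
    fix y assume "y \<in> (\<lambda>k. enc (k # dec x)) ` {..<c (length (dec x))}"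
    then obtain k where "k < c (length (dec x))" "y = enc (k # dec x)" by auto
    then have "dec y = k # dec x" using dec[of x] by (simp add: dec_enc tree_paths_Cons_iff)
    then show "y \<in> {y. y \<noteq> enc [] \<and> enc (tl (dec y)) = x}" by (simp add: root enc_dec)
  qed
  have inj: "inj_on (\<lambda>k. enc (k # dec x)) {..<c (length (dec x))}" for x
  proof (rule inj_onI)
    fix j k assume jk: "j \<in> {..<c (length (dec x))}" "k \<in> {..<c (length (dec x))}"
      "enc (j # dec x) = enc (k # dec x)"
    then have "j # dec x \<in> ?V" "k # dec x \<in> ?V" using dec[of x] by (auto simp: tree_paths_Cons_iff)
    then have "j # dec x = k # dec x" using jk(3) dec_enc by metis
    then show "j = k" by simp
  qed
  have "level_tree (enc []) (\<lambda>x. enc (tl (dec x))) (\<lambda>x. length (dec x)) D"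
  proof
    show "length (dec x) = 0 \<longleftrightarrow> x = enc []" for x using root by simp
    show "length (dec x) = Suc (length (dec (enc (tl (dec x)))))" if "x \<noteq> enc []" for x
      using that by (simp add: dec_enc[OF tl[OF dec]] root)
    show "finite {y. y \<noteq> enc [] \<and> enc (tl (dec y)) = x}" for x unfolding children by simp
    show "card {y. y \<noteq> enc [] \<and> enc (tl (dec y)) = x} =
        (if x = enc [] then D 0 else D (length (dec x)) - 1)" for x
      unfolding children card_image[OF inj] by (simp add: c_def root)
    show "D l = 3 \<or> D l = 4" for l by (rule D)
  qed
  then show ?thesis by blast
qed

text \<open>
  A block of levels starting at \<open>m\<close> has to be longer than the time, of order \<open>(3 / 2) ^ m\<close> in our
  bound, that the walk needs to enter its interior.
\<close>

definition block_length :: "nat \<Rightarrow> nat \<Rightarrow> nat" where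
  "block_length m k = nat \<lceil>real (Suc k) * (18 * (1 + (3 / 2) ^ (m + k)))\<rceil>"

text \<open>The summand \<open>3 * k\<close> is slack for every \<open>N \<le> k\<close>: part of it
  gives depth \<open>N\<close> inside the block, part of it \<open>N\<close> further levels above
  \<open>n\<close>.\<close>

primrec block_start :: "nat \<Rightarrow> nat" where
  "block_start 0 = 0"
| "block_start (Suc k) = block_start k + 3 * k + block_length (block_start k) k + 1"

lemma strict_mono_block_start: "strict_mono block_start"
proof (rule strict_monoI_Suc)
  show "block_start k < block_start (Suc k)" for k
    unfolding block_start.simps by linarith
qed

definition block_degree :: "nat \<Rightarrow> nat" where
  "block_degree l = (if \<exists>k. even k \<and> block_start k \<le> l \<and> l < block_start (Suc k) then 3 else 4)"

lemma block_degree_eq: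
  assumes "block_start k \<le> l" "l < block_start (Suc k)"
  shows "block_degree l = (if even k then 3 else 4)"
proof -
  have unique: "j = k" if "block_start j \<le> l" "l < block_start (Suc j)" for j
  proof -
    have "block_start j < block_start (Suc k)" "block_start k < block_start (Suc j)"
      using that assms by linarith+
    then have "j < Suc k" "k < Suc j"
      unfolding strict_mono_less[OF strict_mono_block_start] .
    then show ?thesis by simp
  qed
  have "(\<exists>j. even j \<and> block_start j \<le> l \<and> l < block_start (Suc j)) \<longleftrightarrow> even k"
    using unique assms by blast
  then show ?thesis unfolding block_degree_def by simp
qed

lemma ex_block_tree: "\<exists>(r :: nat) p lev. block_tree r p lev block_degree"
proof -
  have "\<exists>(r :: nat) p lev. level_tree r p lev block_degree"
    by (rule ex_tree) (simp add: block_degree_def)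
  then obtain r :: nat and p lev where "level_tree r p lev block_degree" by blast
  then interpret level_tree r p lev block_degree .
  have "block_tree r p lev block_degree"
  proof
    fix d N :: nat assume "d = 3 \<or> d = 4"
    \<comment> \<open>Both degrees recur with arbitrarily large block index, and a block of index
      \<open>k \<ge> N\<close> meets the requirements for \<open>N\<close>.\<close>
    then have "\<exists>k\<ge>N. d = (if even k then 3 else 4)"
    proof
      assume "d = 3"
      then show ?thesis by (intro exI[of _ "2 * N"]) simp
    next
      assume "d = 4"
      then show ?thesis by (intro exI[of _ "Suc (2 * N)"]) simp
    qed
    then obtain k where k: "N \<le> k" "d = (if even k then 3 else 4)" by blast
    \<comment> \<open>Chosen so that exactly \<open>k\<close> levels of the block remain above
      \<open>n\<close>.\<close>
    define n where "n = block_start k + 2 * k + block_length (block_start k) k"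
    have n: "block_start (Suc k) = Suc (n + k)" by (simp add: n_def)
    have "real (Suc N) * (18 * (1 + (3 / 2) ^ (block_start k + N))) \<le>
        real (Suc k) * (18 * (1 + (3 / 2) ^ (block_start k + k)))"
      using k(1) by (intro mult_mono add_mono power_increasing) auto
    also have "\<dots> \<le> real (block_length (block_start k) k)"
      unfolding block_length_def by (rule real_nat_ceiling_ge)
    also have "\<dots> \<le> real (Suc n)"
      unfolding n_def by (intro of_nat_mono) simp
    finally have "real (Suc N) * (18 * (1 + (3 / 2) ^ (block_start k + N))) \<le> real (Suc n)" .
    moreover have "block_start k + N \<le> n" using k(1) by (simp add: n_def)
    moreover have "block_degree l = d" if "block_start k \<le> l" "l \<le> n + N" for l
      unfolding k(2) by (rule block_degree_eq) (use that n k(1) in auto)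
    ultimately show "\<exists>m n. m + N \<le> n \<and>
        real (Suc N) * (18 * (1 + (3 / 2) ^ (m + N))) \<le> real (Suc n) \<and>
        (\<forall>l. m \<le> l \<longrightarrow> l \<le> n + N \<longrightarrow> block_degree l = d)"
      by blast
  qed
  then show ?thesis by blast
qed

theorem theorem1p3:
  shows "\<exists>(E :: nat \<Rightarrow> nat \<Rightarrow> bool) (\<mu> :: nat \<Rightarrow> nat \<Rightarrow> real) (r :: nat).
    weighted_graph E \<mu> \<and>
    F1 \<mu> < F2 \<mu> \<and>
    condition_U E \<mu> \<and>
    liminf (\<lambda>n. ereal (expected_range \<mu> r n / real n)) = ereal (1 - F2 \<mu>) \<and>
    limsup (\<lambda>n. ereal (expected_range \<mu> r n / real n)) = ereal (1 - F1 \<mu>)"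
proof -
  obtain r :: nat and p lev where "block_tree r p lev block_degree"
    using ex_block_tree by blast
  then interpret block_tree r p lev block_degree .
  show ?thesis
  proof (intro exI conjI)
    show "weighted_graph adj weight" by (rule weighted_graph_axioms)
    show "condition_U adj weight" by (rule condition_U)
    show "F1 weight < F2 weight" by (simp add: F1_eq F2_eq)
    show "liminf (\<lambda>n. ereal (expected_range weight r n / real n)) = ereal (1 - F2 weight)"
      unfolding liminf_range F2_eq by simp
    show "limsup (\<lambda>n. ereal (expected_range weight r n / real n)) = ereal (1 - F1 weight)"
      unfolding limsup_range F1_eq by simp
  qed
qed

end
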